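(* For each of the groups $\mathbb{Z}/17\mathbb{Z}\oplus\mathbb{Z}$, $\mathbb{Z}/21\mathbb{Z}\oplus\mathbb{Z}$, $\mathbb{Z}/3\mathbb{Z}\oplus\mathbb{Z}/9\mathbb{Z}\oplus\mathbb{Z}$, $\mathbb{Z}/4\mathbb{Z}\oplus\mathbb{Z}/8\mathbb{Z}\oplus\mathbb{Z}$, and $\mathbb{Z}/5\mathbb{Z}\oplus\mathbb{Z}/5\mathbb{Z}\oplus\mathbb{Z}$, there exist a quartic number field $K$ and an elliptic curve $E$ over $K$ whose Mordell--Weil group $E(K)$ contains a subgroup isomorphic to that group. *)

theory Defs
  imports
    Complex_Main
    "HOL-Algebra.Elementary_Groups"
    "HOL-Algebra.Embedded_Algebras"
    "HOL-Algebra.Algebraic_Closure_Type"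
begin

text \<open>
  Every number field embeds into the complex numbers, so number fields are taken to be
  subfields of \<^typ>\<open>complex\<close> of finite degree over the rationals.
\<close>

definition number_field_of_degree :: "nat \<Rightarrow> complex set \<Rightarrow> bool"
  where "number_field_of_degree n K \<longleftrightarrow>
    subfield K ring_of_type_algebra \<and> ring.dimension ring_of_type_algebra n \<rat> K"

text \<open>
  \<open>Weierstrass a1 a2 a3 a4 a6\<close> stands for the curve
  $y^2 + a_1 x y + a_3 y = x^3 + a_2 x^2 + a_4 x + a_6$.
\<close>

datatype 'a weierstrass = Weierstrass 'a 'a 'a 'a 'a

fun discriminant :: "'a::field weierstrass \<Rightarrow> 'a"
  where "discriminant (Weierstrass a1 a2 a3 a4 a6) =
    (let b2 = a1\<^sup>2 + 4 * a2;
         b4 = 2 * a4 + a1 * a3;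
         b6 = a3\<^sup>2 + 4 * a6;
         b8 = a1\<^sup>2 * a6 + 4 * a2 * a6 - a1 * a3 * a4 + a2 * a3\<^sup>2 - a4\<^sup>2
     in - b2\<^sup>2 * b8 - 8 * b4 ^ 3 - 27 * b6\<^sup>2 + 9 * b2 * b4 * b6)"

definition elliptic_curve_over :: "'a::field set \<Rightarrow> 'a weierstrass \<Rightarrow> bool"
  where "elliptic_curve_over K E \<longleftrightarrow> set_weierstrass E \<subseteq> K \<and> discriminant E \<noteq> 0"

datatype 'a point = Point_at_infinity | Affine_point 'a 'a

fun on_curve :: "'a::field weierstrass \<Rightarrow> 'a point \<Rightarrow> bool"
  where
    "on_curve E Point_at_infinity \<longleftrightarrow> True"
  | "on_curve (Weierstrass a1 a2 a3 a4 a6) (Affine_point x y) \<longleftrightarrow>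
       y\<^sup>2 + a1 * x * y + a3 * y = x ^ 3 + a2 * x\<^sup>2 + a4 * x + a6"

text \<open>
  The chord-tangent law. For two affine points on the curve, the sum is the point at infinity
  iff the second is the negative \<open>(x1, - y1 - a1 * x1 - a3)\<close> of the first; otherwise \<open>l\<close> is
  the slope of the line through them (of the tangent line if they coincide), and the sum is
  the negative of the third point of intersection of that line with the curve.
\<close>

fun point_add :: "'a::field weierstrass \<Rightarrow> 'a point \<Rightarrow> 'a point \<Rightarrow> 'a point"
  where
    "point_add E Point_at_infinity Q = Q"
  | "point_add E (Affine_point x1 y1) Point_at_infinity = Affine_point x1 y1"
  | "point_add (Weierstrass a1 a2 a3 a4 a6) (Affine_point x1 y1) (Affine_point x2 y2) =
      (if x1 = x2 \<and> y2 = - y1 - a1 * x1 - a3 then Point_at_infinity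
       else
         let l = (if x1 = x2
                  then (3 * x1\<^sup>2 + 2 * a2 * x1 + a4 - a1 * y1) / (2 * y1 + a1 * x1 + a3)
                  else (y2 - y1) / (x2 - x1));
             x3 = l\<^sup>2 + a1 * l - a2 - x1 - x2;
             y3 = y1 + l * (x3 - x1)
         in Affine_point x3 (- y3 - a1 * x3 - a3))"

definition mordell_weil_group :: "'a::field set \<Rightarrow> 'a weierstrass \<Rightarrow> 'a point monoid"
  where "mordell_weil_group K E =
    \<lparr>carrier = {P. on_curve E P \<and> set_point P \<subseteq> K},
     monoid.mult = point_add E,
     one = Point_at_infinity\<rparr>"

definition contains_subgroup_iso :: "('a, 'm) monoid_scheme \<Rightarrow> ('b, 'n) monoid_scheme \<Rightarrow> bool"
  where "contains_subgroup_iso M G \<longleftrightarrow> (\<exists>H. subgroup H M \<and> M\<lparr>carrier := H\<rparr> \<cong> G)"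

end

theory Submission
  imports Defs
begin

text \<open>
  Each group is realised by an explicit curve over an explicit quartic field, with explicit
  torsion points and an explicit point \<open>Q\<close> of infinite order. Torsion is checked by doubling.

  Infinite order is a 2-adic statement. Let \<open>I\<close> be a proper ideal of a ring \<open>R\<close>
  that contains the coefficients of the curve, with \<open>4 \<in> I\<close>. If \<open>x(Q) = D / N\<close> with
  \<open>D \<in> 1 + I\<close> and \<open>N \<in> 4 I\<close>, then the duplication formula gives \<open>x(2 Q) = D' / (4 U N)\<close> with
  \<open>D', U \<in> 1 + I\<close>. So \<open>2 ^ i Q = 2 ^ j Q\<close> with \<open>i < j\<close> would put an element of \<open>1 + I\<close> into \<open>I\<close>,
  whereas the powers of two times a torsion point form a finite set.

  Associativity of \<open>P + Q + R\<close> under the chord-tangent law is computed only for \<open>R\<close> in general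
  position with respect to \<open>P\<close> and \<open>Q\<close>, after a linear change of coordinates that turns the line
  through \<open>P\<close> and \<open>Q\<close> into the \<open>x\<close>-axis. The other cases follow because over the complex numbers a
  fourth point in general position can be added and then cancelled.
\<close>

section \<open>The group law\<close>

text \<open>The condition on \<open>x(Q)\<close> is the torsion-free range of the formal group in
  elementary terms. At a prime above 2 with valuation \<open>v\<close>, the parameter
  \<open>z = - x / y\<close> of a point in the kernel of reduction satisfies
  \<open>v(x) = - 2 v(z)\<close>. So \<open>N \<in> 4 I\<close> and \<open>D \<in> 1 + I\<close>
  give \<open>v(z) > v(2)\<close>, and \<open>v(p) / (p - 1)\<close> with \<open>p = 2\<close> is
  exactly the bound beyond which the formal group has no torsion. The residue field is always the
  field with two elements, read off from the parity of one coordinate. This dictates the generators: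
  they satisfy equations with even constant term, hence \<open>1 + \<i>\<close> and
  \<open>1 + \<surd>5\<close> instead of \<open>\<i>\<close> and \<open>\<surd>5\<close>. Field
  arithmetic is exact. Numbers are coordinate vectors over \<rat>, products follow a multiplication
  table, and a quantity is shown to be nonzero by exhibiting its inverse.\<close>

fun point_neg :: "'a::field_char_0 weierstrass \<Rightarrow> 'a point \<Rightarrow> 'a point"
  where
    "point_neg E Point_at_infinity = Point_at_infinity"
  | "point_neg (Weierstrass a1 a2 a3 a4 a6) (Affine_point x y) = Affine_point x (- y - a1 * x - a3)"

lemma point_add_infinity_right [simp]: "point_add E P Point_at_infinity = P"
  by (cases P) auto

lemma point_neg_neg [simp]: "point_neg E (point_neg E P) = P"
  by (cases E; cases P) auto

lemma on_curve_neg [simp]: "on_curve E (point_neg E P) \<longleftrightarrow> on_curve E P"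
  by (cases E; cases P) (auto simp: algebra_simps power2_eq_square)

lemma point_add_neg [simp]: "point_add E P (point_neg E P) = Point_at_infinity"
  by (cases E; cases P) auto

lemma same_x_cases:
  fixes x :: "'a::field_char_0"
  assumes "on_curve (Weierstrass a1 a2 a3 a4 a6) (Affine_point x y1)"
    and "on_curve (Weierstrass a1 a2 a3 a4 a6) (Affine_point x y2)"
  shows "y2 = y1 \<or> y2 = - y1 - a1 * x - a3"
proof -
  have "(y2 - y1) * (y2 + y1 + a1 * x + a3) = 0"
    using assms unfolding on_curve.simps by Groebner_Basis.algebra
  then consider "y2 - y1 = 0" | "y2 + y1 + a1 * x + a3 = 0"
    by auto
  then show ?thesis
    by cases (simp, Groebner_Basis.algebra)
qed

lemma point_add_commute:
  fixes E :: "'a::field_char_0 weierstrass"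
  assumes "on_curve E P" "on_curve E Q"
  shows "point_add E P Q = point_add E Q P"
proof (cases P; cases Q)
  fix x1 y1 x2 y2
  assume P: "P = Affine_point x1 y1" and Q: "Q = Affine_point x2 y2"
  obtain a1 a2 a3 a4 a6 where E: "E = Weierstrass a1 a2 a3 a4 a6" by (cases E)
  show ?thesis
  proof (cases "x1 = x2")
    case True
    then show ?thesis
      using same_x_cases[of a1 a2 a3 a4 a6 x1 y1 y2] assms by (auto simp: P Q E)
  next
    case False
    define l where "l = (y2 - y1) / (x2 - x1)"
    have l: "(y1 - y2) / (x1 - x2) = l"
      unfolding l_def by (metis minus_diff_eq minus_divide_divide)
    have y2: "y2 = y1 + l * (x2 - x1)"
      using False by (simp add: l_def)
    show ?thesis
      using False by (simp add: P Q E l Let_def flip: l_def) (simp add: y2 algebra_simps)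
  qed
qed auto

lemma point_add_double:
  fixes l :: "'a::field_char_0"
  assumes "2 * y + a1 * x + a3 \<noteq> 0"
    and "l * (2 * y + a1 * x + a3) = 3 * x\<^sup>2 + 2 * a2 * x + a4 - a1 * y"
    and "x' = l\<^sup>2 + a1 * l - a2 - 2 * x" and "y' = - (y + l * (x' - x)) - a1 * x' - a3"
  shows "point_add (Weierstrass a1 a2 a3 a4 a6) (Affine_point x y) (Affine_point x y) = Affine_point x' y'"
proof -
  have 1: "y \<noteq> - y - a1 * x - a3"
    using assms(1) by Groebner_Basis.algebra
  have 2: "l = (3 * x\<^sup>2 + 2 * a2 * x + a4 - a1 * y) / (2 * y + a1 * x + a3)"
    using assms(1,2) by (simp add: eq_divide_eq)
  have 3: "x' = l\<^sup>2 + a1 * l - a2 - x - x"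
    using assms(3) by (simp add: algebra_simps)
  show ?thesis
    using 1 by (simp add: Let_def assms(4) flip: 2) (simp add: 3)
qed

lemma point_add_chord:
  fixes l :: "'a::field_char_0"
  assumes "x1 \<noteq> x2" and "l * (x2 - x1) = y2 - y1"
    and "x' = l\<^sup>2 + a1 * l - a2 - x1 - x2" and "y' = - (y1 + l * (x' - x1)) - a1 * x' - a3"
  shows "point_add (Weierstrass a1 a2 a3 a4 a6) (Affine_point x1 y1) (Affine_point x2 y2) = Affine_point x' y'"
proof -
  have l: "l = (y2 - y1) / (x2 - x1)"
    using assms(1,2) by (simp add: eq_divide_eq)
  show ?thesis
    using assms(1) by (simp add: Let_def assms(4) flip: l) (simp add: assms(3))
qed

text \<open>Every addition of two affine points that is not of the form \<open>P + (-P)\<close> takes place on a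
  line of some slope \<open>l\<close>: the cubic restricted to that line has the three roots \<open>x1\<close>, \<open>x2\<close>, \<open>x'\<close>.\<close>

lemma point_add_line:
  fixes x1 :: "'a::field_char_0"
  assumes "on_curve (Weierstrass a1 a2 a3 a4 a6) (Affine_point x1 y1)"
    and "on_curve (Weierstrass a1 a2 a3 a4 a6) (Affine_point x2 y2)"
    and "\<not> (x1 = x2 \<and> y2 = - y1 - a1 * x1 - a3)"
  obtains l x' where "y2 = y1 + l * (x2 - x1)"
    and "x' = l\<^sup>2 + a1 * l - a2 - x1 - x2"
    and "l * (y1 + y2 + a1 * x2 + a3) = x1\<^sup>2 + x1 * x2 + x2\<^sup>2 + a2 * (x1 + x2) + a4 - a1 * y1"
    and "point_add (Weierstrass a1 a2 a3 a4 a6) (Affine_point x1 y1) (Affine_point x2 y2)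
          = Affine_point x' (- (y1 + l * (x' - x1)) - a1 * x' - a3)"
proof (cases "x1 = x2")
  case True
  then have y: "y2 = y1"
    using same_x_cases assms by blast
  have nz: "2 * y1 + a1 * x1 + a3 \<noteq> 0"
  proof
    assume "2 * y1 + a1 * x1 + a3 = 0"
    then have "y1 = - y1 - a1 * x1 - a3" by Groebner_Basis.algebra
    with assms(3) True y show False by simp
  qed
  define l where "l = (3 * x1\<^sup>2 + 2 * a2 * x1 + a4 - a1 * y1) / (2 * y1 + a1 * x1 + a3)"
  have l: "l * (2 * y1 + a1 * x1 + a3) = 3 * x1\<^sup>2 + 2 * a2 * x1 + a4 - a1 * y1"
    using nz by (simp add: l_def)
  show ?thesis
  proof (rule that[of l "l\<^sup>2 + a1 * l - a2 - x1 - x2"])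
    show "l * (y1 + y2 + a1 * x2 + a3) = x1\<^sup>2 + x1 * x2 + x2\<^sup>2 + a2 * (x1 + x2) + a4 - a1 * y1"
      using l True y by Groebner_Basis.algebra
  qed (use True y point_add_double[OF nz l] in \<open>auto simp: algebra_simps\<close>)
next
  case False
  define l where "l = (y2 - y1) / (x2 - x1)"
  have l: "l * (x2 - x1) = y2 - y1"
    using False by (simp add: l_def)
  have "(x2 - x1) * (l * (y1 + y2 + a1 * x2 + a3)) = (x2 - x1) * (x1\<^sup>2 + x1 * x2 + x2\<^sup>2 + a2 * (x1 + x2) + a4 - a1 * y1)"
    using assms(1,2) l unfolding on_curve.simps by Groebner_Basis.algebra
  then have *: "l * (y1 + y2 + a1 * x2 + a3) = x1\<^sup>2 + x1 * x2 + x2\<^sup>2 + a2 * (x1 + x2) + a4 - a1 * y1"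
    using False by simp
  show ?thesis
    by (rule that[of l "l\<^sup>2 + a1 * l - a2 - x1 - x2"])
       (use False l * point_add_chord[OF False l] in \<open>auto simp: algebra_simps\<close>)
qed

lemma on_curve_add:
  fixes E :: "'a::field_char_0 weierstrass"
  assumes "on_curve E P" "on_curve E Q"
  shows "on_curve E (point_add E P Q)"
proof (cases P; cases Q)
  fix x1 y1 x2 y2
  assume P: "P = Affine_point x1 y1" and Q: "Q = Affine_point x2 y2"
  obtain a1 a2 a3 a4 a6 where E: "E = Weierstrass a1 a2 a3 a4 a6" by (cases E)
  show ?thesis
  proof (cases "x1 = x2 \<and> y2 = - y1 - a1 * x1 - a3")
    case True
    then show ?thesis by (simp add: P Q E)
  next
    case False
    note on = assms[unfolded P Q E]
    from point_add_line[OF on False] obtain l x' where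
      l: "y2 = y1 + l * (x2 - x1)" "x' = l\<^sup>2 + a1 * l - a2 - x1 - x2"
        "l * (y1 + y2 + a1 * x2 + a3) = x1\<^sup>2 + x1 * x2 + x2\<^sup>2 + a2 * (x1 + x2) + a4 - a1 * y1"
      and s: "point_add E P Q = Affine_point x' (- (y1 + l * (x' - x1)) - a1 * x' - a3)"
      unfolding P Q E by blast
    have "x'\<^sup>2 + x' * x1 + x1\<^sup>2 + a2 * (x' + x1) + a4 - a1 * y1
        = l * (y1 + (y1 + l * (x' - x1)) + a1 * x' + a3)"
      using l by Groebner_Basis.algebra
    with on(1) have "on_curve E (point_neg E (Affine_point x' (y1 + l * (x' - x1))))"
      unfolding on_curve_neg unfolding E on_curve.simps by Groebner_Basis.algebra
    then show ?thesis
      unfolding s by (simp add: E)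
  qed
qed (use assms in auto)

text \<open>The last two hypotheses say that both partial derivatives vanish. The three equations
  can be solved for \<open>a3\<close>, \<open>a4\<close>, \<open>a6\<close>, and then the
  discriminant is identically zero.\<close>

lemma singular_point_imp_discriminant_0:
  fixes x :: "'a::field_char_0"
  assumes "on_curve (Weierstrass a1 a2 a3 a4 a6) (Affine_point x y)"
    and "2 * y + a1 * x + a3 = 0" and "3 * x\<^sup>2 + 2 * a2 * x + a4 - a1 * y = 0"
  shows "discriminant (Weierstrass a1 a2 a3 a4 a6) = 0"
proof -
  have a3: "a3 = - 2 * y - a1 * x"
    using assms(2) by Groebner_Basis.algebra
  have a4: "a4 = a1 * y - 3 * x\<^sup>2 - 2 * a2 * x"
    using assms(3) by Groebner_Basis.algebra
  have a6: "a6 = y\<^sup>2 + a1 * x * y + a3 * y - x ^ 3 - a2 * x\<^sup>2 - a4 * x"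
    using assms(1) by simp
  show ?thesis
    unfolding a6 a4 a3 by (simp add: Let_def) Groebner_Basis.algebra
qed

text \<open>Negation reflects the chord of slope \<open>l\<close> into the line of slope
  \<open>- l - a1\<close> through the negatives of the same three points, so adding
  \<open>- Q\<close> returns \<open>P\<close>. The discriminant enters when
  \<open>P + Q = - Q\<close>: the second addition is then a doubling, and its slope could fail to
  exist only at a singular point.\<close>

lemma point_add_cancel:
  fixes E :: "'a::field_char_0 weierstrass"
  assumes E0: "discriminant E \<noteq> 0" and onP: "on_curve E P" and onQ: "on_curve E Q"
  shows "point_add E (point_add E P Q) (point_neg E Q) = P"
proof (cases P; cases Q)
  assume "P = Point_at_infinity"
  then show ?thesis by simp
next
  fix x1 y1 x2 y2
  assume P: "P = Affine_point x1 y1" and Q: "Q = Affine_point x2 y2"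
  obtain a1 a2 a3 a4 a6 where E: "E = Weierstrass a1 a2 a3 a4 a6" by (cases E)
  show ?thesis
  proof (cases "x1 = x2 \<and> y2 = - y1 - a1 * x1 - a3")
    case True
    then show ?thesis by (simp add: P Q E)
  next
    case False
    note on = onP[unfolded P E] onQ[unfolded Q E]
    from point_add_line[OF on False] obtain l x' where
      l: "y2 = y1 + l * (x2 - x1)" "x' = l\<^sup>2 + a1 * l - a2 - x1 - x2"
        "l * (y1 + y2 + a1 * x2 + a3) = x1\<^sup>2 + x1 * x2 + x2\<^sup>2 + a2 * (x1 + x2) + a4 - a1 * y1"
      and s: "point_add E P Q = Affine_point x' (- (y1 + l * (x' - x1)) - a1 * x' - a3)"
      unfolding P Q E by blast
    let ?y' = "- (y1 + l * (x' - x1)) - a1 * x' - a3" and ?y2 = "- y2 - a1 * x2 - a3"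
    have negQ: "point_neg E Q = Affine_point x2 ?y2"
      by (simp add: Q E)
    show ?thesis
    proof (cases "x' = x2")
      case True
      then have y': "?y' = ?y2"
        using l(1) by simp
      have slope: "l * (2 * y2 + a1 * x2 + a3) = 3 * x2\<^sup>2 + 2 * a2 * x2 + a4 - a1 * y2"
        using l True by Groebner_Basis.algebra
      have nz: "2 * y2 + a1 * x2 + a3 \<noteq> 0"
        using singular_point_imp_discriminant_0[OF on(2)] slope E0 E by auto
      have "point_add E (Affine_point x2 ?y2) (Affine_point x2 ?y2) = Affine_point x1 y1"
        unfolding E
      proof (rule point_add_double[where l = "- l - a1"])
        show "2 * ?y2 + a1 * x2 + a3 \<noteq> 0"
          using nz by Groebner_Basis.algebra
        show "(- l - a1) * (2 * ?y2 + a1 * x2 + a3) = 3 * x2\<^sup>2 + 2 * a2 * x2 + a4 - a1 * ?y2"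
          using slope by Groebner_Basis.algebra
        show "x1 = (- l - a1)\<^sup>2 + a1 * (- l - a1) - a2 - 2 * x2"
          using l(2)[unfolded True] by Groebner_Basis.algebra
        show "y1 = - (?y2 + (- l - a1) * (x1 - x2)) - a1 * x1 - a3"
          using l(1) by Groebner_Basis.algebra
      qed
      then show ?thesis
        using s[unfolded True y'[unfolded True]] negQ P by simp
    next
      case x: False
      have "point_add E (Affine_point x' ?y') (Affine_point x2 ?y2) = Affine_point x1 y1"
        unfolding E
      proof (rule point_add_chord[OF x, where l = "- l - a1"])
        show "(- l - a1) * (x2 - x') = ?y2 - ?y'"
          using l(1) by Groebner_Basis.algebra
        show "x1 = (- l - a1)\<^sup>2 + a1 * (- l - a1) - a2 - x' - x2"
          using l(2) by Groebner_Basis.algebra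
        show "y1 = - (?y' + (- l - a1) * (x1 - x')) - a1 * x1 - a3"
          by Groebner_Basis.algebra
      qed
      then show ?thesis
        using s negQ P by simp
    qed
  qed
qed (auto)

section \<open>Linear changes of coordinates\<close>

fun point_shift :: "'a::field_char_0 \<Rightarrow> 'a \<Rightarrow> 'a \<Rightarrow> 'a point \<Rightarrow> 'a point"
  where
    "point_shift u s t Point_at_infinity = Point_at_infinity"
  | "point_shift u s t (Affine_point x y) = Affine_point (x - u) (y - s * (x - u) - t)"

text \<open>These are the coefficients after substituting \<open>x = X + u\<close>,
  \<open>y = Y + s X + t\<close>. Lines of slope \<open>l\<close> become lines of slope
  \<open>l - s\<close>.\<close>

fun curve_shift :: "'a::field_char_0 \<Rightarrow> 'a \<Rightarrow> 'a \<Rightarrow> 'a weierstrass \<Rightarrow> 'a weierstrass"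
  where
    "curve_shift u s t (Weierstrass a1 a2 a3 a4 a6) =
       Weierstrass (a1 + 2 * s) (a2 - s * a1 + 3 * u - s\<^sup>2) (a3 + u * a1 + 2 * t)
         (a4 - s * a3 + 2 * u * a2 - (t + u * s) * a1 + 3 * u\<^sup>2 - 2 * s * t)
         (a6 + u * a4 + u\<^sup>2 * a2 + u ^ 3 - t * a3 - t\<^sup>2 - u * t * a1)"

lemma point_shift_inject [simp]: "point_shift u s t P = point_shift u s t Q \<longleftrightarrow> P = Q"
  by (cases P; cases Q) auto

lemma on_curve_shift [simp]: "on_curve (curve_shift u s t E) (point_shift u s t P) \<longleftrightarrow> on_curve E P"
proof (cases P)
  case (Affine_point x y)
  obtain a1 a2 a3 a4 a6 where E: "E = Weierstrass a1 a2 a3 a4 a6" by (cases E)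
  show ?thesis
    unfolding E Affine_point point_shift.simps curve_shift.simps on_curve.simps by Groebner_Basis.algebra
qed (cases E, simp)

lemma point_shift_neg: "point_shift u s t (point_neg E P) = point_neg (curve_shift u s t E) (point_shift u s t P)"
  by (cases E; cases P) (auto simp: algebra_simps)

lemma point_shift_add:
  assumes onP: "on_curve E P" and onQ: "on_curve E Q"
  shows "point_shift u s t (point_add E P Q)
    = point_add (curve_shift u s t E) (point_shift u s t P) (point_shift u s t Q)"
proof (cases P; cases Q)
  fix x1 y1 x2 y2
  assume P: "P = Affine_point x1 y1" and Q: "Q = Affine_point x2 y2"
  obtain a1 a2 a3 a4 a6 where E: "E = Weierstrass a1 a2 a3 a4 a6" by (cases E)
  show ?thesis
  proof (cases "Q = point_neg E P")
    case True
    then show ?thesis by (simp add: point_shift_neg)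
  next
    case False
    then have F: "\<not> (x1 = x2 \<and> y2 = - y1 - a1 * x1 - a3)"
      by (auto simp: P Q E)
    note on = onP[unfolded P E] onQ[unfolded Q E]
    from point_add_line[OF on F] obtain l x' where
      l: "y2 = y1 + l * (x2 - x1)" "x' = l\<^sup>2 + a1 * l - a2 - x1 - x2"
        "l * (y1 + y2 + a1 * x2 + a3) = x1\<^sup>2 + x1 * x2 + x2\<^sup>2 + a2 * (x1 + x2) + a4 - a1 * y1"
      and sum: "point_add E P Q = Affine_point x' (- (y1 + l * (x' - x1)) - a1 * x' - a3)"
      unfolding P Q E by blast
    show ?thesis
    proof (cases "x1 = x2")
      case True
      then have y: "y1 = y2"
        using l(1) by simp
      have nz: "2 * y1 + a1 * x1 + a3 \<noteq> 0"
      proof -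
        have "y1 \<noteq> - y1 - a1 * x1 - a3"
          using F True y by simp
        then show ?thesis by Groebner_Basis.algebra
      qed
      have slope: "l * (2 * y1 + a1 * x1 + a3) = 3 * x1\<^sup>2 + 2 * a2 * x1 + a4 - a1 * y1"
        using l(3)[folded True y] by Groebner_Basis.algebra
      have x': "x' = l\<^sup>2 + a1 * l - a2 - 2 * x1"
        using l(2)[folded True] by Groebner_Basis.algebra
      show ?thesis
        unfolding sum unfolding P Q E point_shift.simps curve_shift.simps True[symmetric] y[symmetric]
      proof (rule point_add_double[symmetric, where l = "l - s"])
        show "2 * (y1 - s * (x1 - u) - t) + (a1 + 2 * s) * (x1 - u) + (a3 + u * a1 + 2 * t) \<noteq> 0"
          using nz by Groebner_Basis.algebra
      qed (use slope in Groebner_Basis.algebra, use x' in Groebner_Basis.algebra, Groebner_Basis.algebra)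
    next
      case x: False
      then have x': "x1 - u \<noteq> x2 - u" by simp
      show ?thesis
        unfolding sum unfolding P Q E point_shift.simps curve_shift.simps
        by (rule point_add_chord[OF x', symmetric, where l = "l - s"])
          (use l(1) in Groebner_Basis.algebra, use l(2) in Groebner_Basis.algebra, Groebner_Basis.algebra)
    qed
  qed
qed auto

text \<open>Associativity when the line through \<open>P = (p, 0)\<close> and \<open>Q = (0, 0)\<close> is the \<open>x\<close>-axis, with
  \<open>(s, 0)\<close> as third point; \<open>p = 0\<close> is the case \<open>P = Q\<close>. With \<open>\<rho> = y / r\<close> and \<open>c = (r - p) / \<rho>\<close>, the
  slopes of the last two additions are \<open>c - a1\<close> and \<open>c - a1 - \<rho>\<close>.\<close>

lemma point_add_assoc_normalized:
  fixes r a1 a3 s p :: "'a::field_char_0"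
  defines "E \<equiv> Weierstrass a1 (- s - p) a3 (p * s) 0"
  assumes on: "on_curve E (Affine_point r y)" and "r \<noteq> 0" "r \<noteq> s" "r \<noteq> p"
    and T: "point_add E (Affine_point 0 0) (Affine_point r y) = Affine_point xt yt" and "xt \<noteq> p"
  shows "point_add E (Affine_point s (- a1 * s - a3)) (Affine_point r y)
    = point_add E (Affine_point p 0) (point_add E (Affine_point 0 0) (Affine_point r y))"
proof -
  have on': "y\<^sup>2 + a1 * r * y + a3 * y = r * (r - p) * (r - s)"
    using on unfolding E_def on_curve.simps by Groebner_Basis.algebra
  then have "y \<noteq> 0"
    using assms(3-5) by auto
  define \<rho> where "\<rho> = y / r"
  define c where "c = (r - p) / \<rho>"
  have y: "y = \<rho> * r" and "\<rho> \<noteq> 0"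
    using \<open>r \<noteq> 0\<close> \<open>y \<noteq> 0\<close> by (auto simp: \<rho>_def)
  have c: "c * \<rho> = r - p"
    using \<open>\<rho> \<noteq> 0\<close> by (simp add: c_def)
  \<comment> \<open>Dividing the curve equation by \<open>y = \<rho> * r\<close> expresses
    \<open>a3\<close> through the other quantities. Together with \<open>p = r - c * \<rho>\<close>
    this turns both sums into polynomial identities.\<close>
  have *: "\<rho> * r * (\<rho> * r + a1 * r + a3) = \<rho> * r * (c * (r - s))"
    using on' c y by Groebner_Basis.algebra
  have a3: "a3 = c * (r - s) - \<rho> * r - a1 * r"
  proof -
    have "\<rho> * r + a1 * r + a3 = c * (r - s)"
      using * \<open>\<rho> \<noteq> 0\<close> \<open>r \<noteq> 0\<close> by (simp only: mult_cancel_left) simp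
    then show ?thesis by Groebner_Basis.algebra
  qed
  have "point_add E (Affine_point 0 0) (Affine_point r y)
      = Affine_point (\<rho>\<^sup>2 + a1 * \<rho> + s + p - r) (- (\<rho> * (\<rho>\<^sup>2 + a1 * \<rho> + s + p - r)) - a1 * (\<rho>\<^sup>2 + a1 * \<rho> + s + p - r) - a3)"
    unfolding E_def by (rule point_add_chord[where l = \<rho>]) (use \<open>r \<noteq> 0\<close> y in \<open>auto simp: algebra_simps\<close>)
  then have xt: "xt = \<rho>\<^sup>2 + a1 * \<rho> + s + p - r" and yt: "yt = - \<rho> * xt - a1 * xt - a3"
    using T by auto
  define x' where "x' = c * (c - a1 - \<rho>)"
  have "point_add E (Affine_point s (- a1 * s - a3)) (Affine_point r y)
      = Affine_point x' (- (y + (c - a1) * (x' - r)) - a1 * x' - a3)"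
    unfolding E_def
    by (rule point_add_chord[where l = "c - a1"])
       (use \<open>r \<noteq> s\<close> in simp, (use c y a3 x'_def in Groebner_Basis.algebra)+)
  moreover have "point_add E (Affine_point p 0) (Affine_point xt yt)
      = Affine_point x' (- (y + (c - a1) * (x' - r)) - a1 * x' - a3)"
    unfolding E_def
    by (rule point_add_chord[where l = "c - a1 - \<rho>"])
       (use \<open>xt \<noteq> p\<close> in simp, (use c y a3 x'_def yt xt in Groebner_Basis.algebra)+)
  ultimately show ?thesis
    by (simp add: T)
qed

lemma same_x_imp_neg:
  assumes "on_curve E (Affine_point x y1)" "on_curve E (Affine_point x y2)"
  shows "Affine_point x y2 = Affine_point x y1 \<or> Affine_point x y2 = point_neg E (Affine_point x y1)"
proof (cases E)
  case (Weierstrass a1 a2 a3 a4 a6)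
  then show ?thesis
    using assms same_x_cases[of a1 a2 a3 a4 a6 x y1 y2] by auto
qed

text \<open>The inequalities on \<open>R\<close> and \<open>Q + R\<close> come in pairs because
  points with equal abscissas agree up to sign. They make the three additions other than
  \<open>P + Q\<close> chords between distinct abscissas; the pair with \<open>P\<close> and its
  negative keeps the slope \<open>\<rho>\<close> of the normalized case nonzero.\<close>

lemma point_add_assoc_generic:
  assumes on: "on_curve E P" "on_curve E Q" "on_curve E R"
    and aff: "P \<noteq> Point_at_infinity" "Q \<noteq> Point_at_infinity" "R \<noteq> Point_at_infinity"
    and "P \<noteq> point_neg E Q"
    and "R \<noteq> P" "R \<noteq> point_neg E P" "R \<noteq> Q" "R \<noteq> point_neg E Q"
    and "R \<noteq> point_add E P Q" "R \<noteq> point_neg E (point_add E P Q)"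
    and "point_add E Q R \<noteq> P" "point_add E Q R \<noteq> point_neg E P"
  shows "point_add E (point_add E P Q) R = point_add E P (point_add E Q R)"
proof -
  obtain x1 y1 x2 y2 x3 y3 where
    P: "P = Affine_point x1 y1" and Q: "Q = Affine_point x2 y2" and R: "R = Affine_point x3 y3"
    using aff by (metis point.exhaust)
  obtain a1 a2 a3 a4 a6 where E: "E = Weierstrass a1 a2 a3 a4 a6" by (cases E)
  have F: "\<not> (x1 = x2 \<and> y2 = - y1 - a1 * x1 - a3)"
    using \<open>P \<noteq> point_neg E Q\<close> by (auto simp: P Q E)
  from point_add_line[OF on(1,2)[unfolded P Q E] F] obtain l x' where
    l: "y2 = y1 + l * (x2 - x1)" "x' = l\<^sup>2 + a1 * l - a2 - x1 - x2"
      "l * (y1 + y2 + a1 * x2 + a3) = x1\<^sup>2 + x1 * x2 + x2\<^sup>2 + a2 * (x1 + x2) + a4 - a1 * y1"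
    and sum: "point_add E P Q = Affine_point x' (- (y1 + l * (x' - x1)) - a1 * x' - a3)"
    unfolding P Q E by blast
  let ?f = "point_shift x2 l y2"
  define A1 A3 p s where "A1 = a1 + 2 * l" and "A3 = a3 + x2 * a1 + 2 * y2"
    and "p = x1 - x2" and "s = x' - x2"
  \<comment> \<open>On the new \<open>x\<close>-axis the cubic has the roots 0, \<open>p\<close>,
    \<open>s\<close>, the shifted abscissas of \<open>Q\<close>, \<open>P\<close> and
    \<open>P + Q\<close>. This determines its coefficients.\<close>
  define E' where "E' = Weierstrass A1 (- s - p) A3 (p * s) 0"
  have E': "curve_shift x2 l y2 E = E'"
  proof -
    have "a2 - l * a1 + 3 * x2 - l\<^sup>2 = - s - p"
      using l(2) unfolding p_def s_def by Groebner_Basis.algebra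
    moreover have "a4 - l * a3 + 2 * x2 * a2 - (y2 + x2 * l) * a1 + 3 * x2\<^sup>2 - 2 * l * y2 = p * s"
      using l unfolding p_def s_def by Groebner_Basis.algebra
    moreover have "a6 + x2 * a4 + x2\<^sup>2 * a2 + x2 ^ 3 - y2 * a3 - y2\<^sup>2 - x2 * y2 * a1 = 0"
      using on(2) unfolding Q E on_curve.simps by Groebner_Basis.algebra
    ultimately show ?thesis
      by (simp add: E E'_def A1_def A3_def)
  qed
  have fP: "?f P = Affine_point p 0" and fQ: "?f Q = Affine_point 0 0"
    using l(1) by (auto simp: P Q p_def algebra_simps)
  have fS: "?f (point_add E P Q) = Affine_point s (- A1 * s - A3)"
    using l(1) by (auto simp: sum s_def A1_def A3_def algebra_simps)
  obtain r y where fR: "?f R = Affine_point r y"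
    by (simp add: R)
  have hom1: "?f (point_add E A B) = point_add E' (?f A) (?f B)" if "on_curve E A" "on_curve E B" for A B
    using point_shift_add[OF that, of x2 l y2] by (simp add: E')
  have neg: "?f (point_neg E A) = point_neg E' (?f A)" for A
    using point_shift_neg[of x2 l y2 E A] by (simp add: E')
  have onf: "on_curve E' (?f A)" if "on_curve E A" for A
    using that on_curve_shift[of x2 l y2 E A] by (simp add: E')
  have onf': "on_curve E' (Affine_point r y)" "on_curve E' (Affine_point 0 0)"
    "on_curve E' (Affine_point p 0)" "on_curve E' (Affine_point s (- A1 * s - A3))"
    using onf[OF on(1)] onf[OF on(2)] onf[OF on(3)] onf[OF on_curve_add[OF on(1,2)]]
    unfolding fP fQ fR fS by auto
  have neqD: "?f A \<noteq> ?f B" if "A \<noteq> B" for A B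
    using that by simp
  have "r \<noteq> 0"
    using same_x_imp_neg[of E' r 0 y] onf' assms(10,11)[THEN neqD] unfolding neg fQ fR by blast
  moreover have "r \<noteq> p"
    using same_x_imp_neg[of E' r 0 y] onf' assms(8,9)[THEN neqD] unfolding neg fP fR by blast
  moreover have "r \<noteq> s"
    using same_x_imp_neg[of E' r "- A1 * s - A3" y] onf' assms(12,13)[THEN neqD] unfolding neg fS fR by blast
  moreover have Tinf: "point_add E' (Affine_point 0 0) (Affine_point r y) \<noteq> Point_at_infinity"
    using \<open>r \<noteq> 0\<close> by (simp add: E'_def Let_def)
  then obtain xt yt where T: "point_add E' (Affine_point 0 0) (Affine_point r y) = Affine_point xt yt"
    by (metis point.exhaust)
  have fT: "?f (point_add E Q R) = Affine_point xt yt"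
    by (simp add: hom1 on fQ fR T)
  have onT: "on_curve E' (Affine_point xt yt)"
    using on_curve_add[OF onf'(2,1)] T by simp
  have "xt \<noteq> p"
    using same_x_imp_neg[of E' p 0 yt] onf' onT assms(14,15)[THEN neqD] unfolding neg fP fT by blast
  ultimately have "point_add E' (Affine_point s (- A1 * s - A3)) (Affine_point r y)
    = point_add E' (Affine_point p 0) (point_add E' (Affine_point 0 0) (Affine_point r y))"
    using point_add_assoc_normalized[of A1 s p A3 r y xt yt] onf'(1) T unfolding E'_def by metis
  then have "?f (point_add E (point_add E P Q) R) = ?f (point_add E P (point_add E Q R))"
    using on by (simp add: hom1 on_curve_add fS fR fT fP T)
  then show ?thesis
    by simp
qed

section \<open>From general position to full associativity\<close>

lemma point_add_infinity_iff:
  "point_add E P Q = Point_at_infinity \<longleftrightarrow> Q = point_neg E P"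
  by (cases E; cases P; cases Q) (auto simp: Let_def)

lemma point_add_eq_iff:
  fixes E :: "'a::field_char_0 weierstrass"
  assumes "discriminant E \<noteq> 0" "on_curve E P" "on_curve E Q" "on_curve E R"
  shows "point_add E P Q = R \<longleftrightarrow> Q = point_add E R (point_neg E P)"
  using assms point_add_cancel[of E Q P] point_add_cancel[of E R "point_neg E P"]
  by (auto simp: point_add_commute)

text \<open>Cancellation solves \<open>Q + R = P\<close> and \<open>Q + R = - P\<close> for
  \<open>R\<close>, so the conditions of general position exclude nine points. If
  \<open>P = - Q\<close>, associativity is cancellation itself.\<close>

lemma finite_point_add_assoc_exceptions:
  fixes E :: "'a::field_char_0 weierstrass"
  assumes E: "discriminant E \<noteq> 0" and P: "on_curve E P" and Q: "on_curve E Q"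
  shows "finite {R. on_curve E R \<and> point_add E (point_add E P Q) R \<noteq> point_add E P (point_add E Q R)}"
proof (cases "P = Point_at_infinity \<or> Q = Point_at_infinity")
  case True
  then have "{R. on_curve E R \<and> point_add E (point_add E P Q) R \<noteq> point_add E P (point_add E Q R)} = {}"
    by auto
  then show ?thesis
    by (simp only: finite.emptyI)
next
  case False
  show ?thesis
  proof (cases "P = point_neg E Q")
    case True
    have "point_add E P (point_add E Q R) = R" if "on_curve E R" for R
      using point_add_cancel[OF E that Q] that P Q by (simp add: True point_add_commute on_curve_add)
    moreover have "point_add E P Q = Point_at_infinity"
      by (simp add: point_add_infinity_iff True)
    ultimately have "{R. on_curve E R \<and> point_add E (point_add E P Q) R \<noteq> point_add E P (point_add E Q R)} = {}"
      by auto
    then show ?thesis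
      by (simp only: finite.emptyI)
  next
    case neq: False
    let ?S = "point_add E P Q" and ?n = "point_neg E"
    have "{R. on_curve E R \<and> point_add E (point_add E P Q) R \<noteq> point_add E P (point_add E Q R)}
      \<subseteq> {Point_at_infinity, P, ?n P, Q, ?n Q, ?S, ?n ?S, point_add E P (?n Q), point_add E (?n P) (?n Q)}"
    proof (rule ccontr)
      assume "\<not> ?thesis"
      then obtain R where R: "on_curve E R" "point_add E (point_add E P Q) R \<noteq> point_add E P (point_add E Q R)"
        and *: "R \<noteq> Point_at_infinity" "R \<noteq> point_add E (?n P) (?n Q)" "R \<noteq> point_add E P (?n Q)"
          "R \<noteq> ?n ?S" "R \<noteq> ?S" "R \<noteq> ?n Q" "R \<noteq> Q" "R \<noteq> ?n P" "R \<noteq> P"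
        by blast
      have "point_add E Q R \<noteq> P" "point_add E Q R \<noteq> ?n P"
        using * R(1) E P Q by (auto simp: point_add_eq_iff)
      then show False
        using point_add_assoc_generic[OF P Q R(1)] * R(2) neq False by blast
    qed
    then show ?thesis
      by (rule finite_subset) simp
  qed
qed

text \<open>By the quadratic formula every complex number is the abscissa of a point. This is why
  associativity is proved over the complex numbers and then inherited by the points over
  \<open>K\<close>.\<close>

lemma infinite_points: "infinite {P. on_curve (E :: complex weierstrass) P}"
proof
  assume fin: "finite {P. on_curve E P}"
  obtain a1 a2 a3 a4 a6 where E: "E = Weierstrass a1 a2 a3 a4 a6" by (cases E)
  have "\<exists>y. on_curve E (Affine_point x y)" for x
  proof -
    define b c where "b = a1 * x + a3" and "c = x ^ 3 + a2 * x\<^sup>2 + a4 * x + a6"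
    define d where "d = csqrt (b\<^sup>2 + 4 * c)"
    have d: "d\<^sup>2 = b\<^sup>2 + 4 * c"
      by (simp add: d_def)
    define y where "y = (d - b) / 2"
    have "y\<^sup>2 + b * y = c"
      using d by (simp add: y_def field_simps power2_eq_square)
    then show ?thesis
      unfolding E by (intro exI[of _ y]) (simp add: b_def c_def distrib_right add.assoc)
  qed
  then have "range (\<lambda>x. x) \<subseteq> (\<lambda>P. case P of Affine_point x y \<Rightarrow> x | Point_at_infinity \<Rightarrow> 0) ` {P. on_curve E P}"
    by (force simp: image_iff split: point.splits)
  then have "finite (UNIV :: complex set)"
    using fin finite_surj by fastforce
  then show False
    by (simp add: infinite_UNIV_char_0)
qed

text \<open>Adding a further point \<open>S\<close> moves all additions into general position, where associativity
  is known; cancelling \<open>S\<close> then gives the full law.\<close>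

theorem point_add_assoc:
  fixes E :: "complex weierstrass"
  assumes E: "discriminant E \<noteq> 0" and on: "on_curve E P" "on_curve E Q" "on_curve E R"
  shows "point_add E (point_add E P Q) R = point_add E P (point_add E Q R)"
proof -
  let ?add = "point_add E" and ?n = "point_neg E"
  define exc where "exc U V = {W. on_curve E W \<and> ?add (?add U V) W \<noteq> ?add U (?add V W)}" for U V
  have fin: "finite (exc U V)" if "on_curve E U" "on_curve E V" for U V
    using finite_point_add_assoc_exceptions[OF E that] by (simp add: exc_def)
  \<comment> \<open>There is one exceptional set for each of the four rebracketings below. The
    second is translated by \<open>- R\<close>, since there it is \<open>R + S\<close> that has to
    avoid \<open>exc P Q\<close>.\<close>
  let ?bad = "exc (?add P Q) R \<union> (\<lambda>W. ?add W (?n R)) ` exc P Q \<union> exc Q R \<union> exc P (?add Q R)"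
  have "finite ?bad"
    using on by (intro finite_UnI finite_imageI fin) (auto simp: on_curve_add)
  then obtain S where S: "on_curve E S" "S \<notin> ?bad"
    using infinite_points[of E] finite_subset[of "{P. on_curve E P}" ?bad] by blast
  have good: "?add (?add U V) W = ?add U (?add V W)" if "on_curve E W" "W \<notin> exc U V" for U V W
    using that by (auto simp: exc_def)
  have RS: "?add R S \<notin> exc P Q"
  proof
    assume "?add R S \<in> exc P Q"
    then have "?add (?add R S) (?n R) \<in> ?bad" by blast
    then show False
      using point_add_cancel[OF E S(1) on(3)] S on by (simp add: point_add_commute)
  qed
  have "?add (?add (?add P Q) R) S = ?add (?add P Q) (?add R S)"
    using S by (intro good) auto
  also have "\<dots> = ?add P (?add Q (?add R S))"
    using S on RS by (intro good) (auto simp: on_curve_add)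
  also have "?add Q (?add R S) = ?add (?add Q R) S"
    using S by (intro good[symmetric]) auto
  also have "?add P (?add (?add Q R) S) = ?add (?add P (?add Q R)) S"
    using S by (intro good[symmetric]) auto
  finally have "?add (?add (?add (?add P Q) R) S) (?n S) = ?add (?add (?add P (?add Q R)) S) (?n S)"
    by simp
  then show ?thesis
    using on S by (simp add: point_add_cancel[OF E] on_curve_add)
qed

section \<open>The Mordell--Weil group\<close>

lemma type_algebra_ops:
  "x \<oplus>\<^bsub>ring_of_type_algebra\<^esub> y = x + y" "x \<otimes>\<^bsub>ring_of_type_algebra\<^esub> y = x * y"
  "\<zero>\<^bsub>ring_of_type_algebra\<^esub> = 0" "\<one>\<^bsub>ring_of_type_algebra\<^esub> = 1"
  "carrier ring_of_type_algebra = UNIV" "\<ominus>\<^bsub>ring_of_type_algebra\<^esub> x = - x" for x y :: complex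
proof -
  interpret R: field "ring_of_type_algebra :: complex ring" ..
  show "\<ominus>\<^bsub>ring_of_type_algebra\<^esub> x = - x" for x :: complex
    using R.minus_equality[of "- x" x] by (simp add: ring_of_type_algebra_def)
qed (simp_all add: ring_of_type_algebra_def)

lemma subfield_closed:
  assumes "subfield K (ring_of_type_algebra :: complex ring)"
  shows "0 \<in> K" "1 \<in> K" and "x \<in> K \<Longrightarrow> y \<in> K \<Longrightarrow> x + y \<in> K" and "x \<in> K \<Longrightarrow> y \<in> K \<Longrightarrow> x * y \<in> K"
    and "x \<in> K \<Longrightarrow> - x \<in> K" and "x \<in> K \<Longrightarrow> y \<in> K \<Longrightarrow> x - y \<in> K" and "x \<in> K \<Longrightarrow> y \<in> K \<Longrightarrow> x / y \<in> K"
    and "numeral n \<in> K" and "x \<in> K \<Longrightarrow> x ^ k \<in> K"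
proof -
  interpret R: field "ring_of_type_algebra :: complex ring" ..
  note sf = subfieldE[OF assms] and sr = subringE[OF subfieldE(1)[OF assms]]
  show 0: "0 \<in> K" and 1: "1 \<in> K" and add: "x \<in> K \<Longrightarrow> y \<in> K \<Longrightarrow> x + y \<in> K"
    and mult: "\<And>x y. x \<in> K \<Longrightarrow> y \<in> K \<Longrightarrow> x * y \<in> K" and uminus: "x \<in> K \<Longrightarrow> - x \<in> K" for x y
    using sr(2,3,5,6,7) by (simp_all add: type_algebra_ops)
  show diff: "x \<in> K \<Longrightarrow> y \<in> K \<Longrightarrow> x - y \<in> K"
    using add[of x "- y"] uminus by simp
  have "inverse z \<in> K" if z: "z \<in> K" for z
  proof (cases "z = 0")
    case True
    then show ?thesis using 0 by simp
  next
    case False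
    have "inv\<^bsub>ring_of_type_algebra\<^esub> z = inverse z"
      by (rule R.comm_inv_char) (use False in \<open>simp_all add: type_algebra_ops\<close>)
    then show ?thesis
      using R.subfield_m_inv(1)[OF assms, of z] z False by (simp add: type_algebra_ops)
  qed
  then show "x \<in> K \<Longrightarrow> y \<in> K \<Longrightarrow> x / y \<in> K"
    using mult by (simp add: divide_inverse)
  show "numeral n \<in> K"
    by (induction n) (use 1 add in \<open>simp_all only: numeral.simps\<close>)
  show "x \<in> K \<Longrightarrow> x ^ k \<in> K"
    by (induction k) (use 1 mult in auto)
qed

lemma comm_group_mordell_weil:
  fixes E :: "complex weierstrass"
  assumes K: "subfield K ring_of_type_algebra" and E: "elliptic_curve_over K E"
  shows "comm_group (mordell_weil_group K E)"
proof -
  obtain a1 a2 a3 a4 a6 where W: "E = Weierstrass a1 a2 a3 a4 a6" by (cases E)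
  have a: "a1 \<in> K" "a2 \<in> K" "a3 \<in> K" "a4 \<in> K" "a6 \<in> K" and d: "discriminant E \<noteq> 0"
    using E by (auto simp: elliptic_curve_over_def W)
  note cl = subfield_closed[OF K]
  have neg: "set_point (point_neg E P) \<subseteq> K" if "set_point P \<subseteq> K" for P
    using that a by (cases P) (auto simp: W intro!: cl)
  have add: "set_point (point_add E P Q) \<subseteq> K" if "set_point P \<subseteq> K" "set_point Q \<subseteq> K" for P Q
    using that a by (cases P; cases Q) (auto simp: W Let_def intro!: cl)
  show ?thesis
  proof (rule comm_groupI)
    fix P Q R
    assume *: "P \<in> carrier (mordell_weil_group K E)" "Q \<in> carrier (mordell_weil_group K E)"
    show "P \<otimes>\<^bsub>mordell_weil_group K E\<^esub> Q \<in> carrier (mordell_weil_group K E)"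
      using * add by (auto simp: mordell_weil_group_def on_curve_add)
    show "P \<otimes>\<^bsub>mordell_weil_group K E\<^esub> Q = Q \<otimes>\<^bsub>mordell_weil_group K E\<^esub> P"
      using * by (auto simp: mordell_weil_group_def point_add_commute)
    assume "R \<in> carrier (mordell_weil_group K E)"
    then show "P \<otimes>\<^bsub>mordell_weil_group K E\<^esub> Q \<otimes>\<^bsub>mordell_weil_group K E\<^esub> R
        = P \<otimes>\<^bsub>mordell_weil_group K E\<^esub> (Q \<otimes>\<^bsub>mordell_weil_group K E\<^esub> R)"
      using * by (auto simp: mordell_weil_group_def point_add_assoc[OF d])
  next
    fix P
    assume *: "P \<in> carrier (mordell_weil_group K E)"
    show "\<exists>Q\<in>carrier (mordell_weil_group K E). Q \<otimes>\<^bsub>mordell_weil_group K E\<^esub> P = \<one>\<^bsub>mordell_weil_group K E\<^esub>"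
      using * neg by (intro bexI[of _ "point_neg E P"])
        (auto simp: mordell_weil_group_def point_add_infinity_iff)
  qed (auto simp: mordell_weil_group_def)
qed

lemma mordell_weil_simps [simp]:
  "x \<otimes>\<^bsub>mordell_weil_group K E\<^esub> y = point_add E x y"
  "\<one>\<^bsub>mordell_weil_group K E\<^esub> = Point_at_infinity"
  "P \<in> carrier (mordell_weil_group K E) \<longleftrightarrow> on_curve E P \<and> set_point P \<subseteq> K"
  by (simp_all add: mordell_weil_group_def)

lemma mordell_weil_pow_double:
  fixes E :: "complex weierstrass"
  assumes "subfield K ring_of_type_algebra" "elliptic_curve_over K E" "P \<in> carrier (mordell_weil_group K E)"
  shows "P [^]\<^bsub>mordell_weil_group K E\<^esub> (2 * n :: nat) =
    point_add E (P [^]\<^bsub>mordell_weil_group K E\<^esub> n) (P [^]\<^bsub>mordell_weil_group K E\<^esub> n)"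
proof -
  interpret comm_group "mordell_weil_group K E"
    using assms(1,2) by (rule comm_group_mordell_weil)
  show ?thesis
    using nat_pow_mult[OF assms(3), of n n] by (simp add: mult_2)
qed

lemma mordell_weil_pow_2:
  "P [^]\<^bsub>mordell_weil_group K E\<^esub> (2 :: nat) = point_add E P P"
  by (simp add: numeral_2_eq_2)

lemma mordell_weil_pow_Suc:
  "P [^]\<^bsub>mordell_weil_group K E\<^esub> Suc n = point_add E (P [^]\<^bsub>mordell_weil_group K E\<^esub> n) P"
  by (simp add: nat_pow_Suc)

section \<open>Independent elements of abelian groups\<close>

lemma (in comm_group) int_pow_mod:
  assumes "x \<in> carrier G" "x [^] (int n) = \<one>"
  shows "x [^] (a mod int n) = x [^] (a :: int)"
proof -
  have "x [^] a = x [^] (int n * (a div int n) + a mod int n)"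
    by simp
  also have "\<dots> = x [^] (a mod int n)"
    using assms by (simp only: int_pow_mult int_pow_pow[symmetric] int_pow_one l_one int_pow_closed)
  finally show ?thesis ..
qed

text \<open>The map sends \<open>(a, b, k)\<close> to \<open>a S + b T + k P\<close>. Multiplying a
  relation by \<open>m n\<close> removes the torsion part and forces \<open>k = 0\<close>; the
  independence of \<open>S\<close> and \<open>T\<close> then applies. The value \<open>m = 1\<close>
  is allowed and covers groups with one finite factor.\<close>

lemma (in comm_group) contains_subgroup_iso_Zmod_Zmod_Z:
  assumes S: "S \<in> carrier G" and T: "T \<in> carrier G" and P: "P \<in> carrier G"
    and mn: "m > 0" "n > 0" and Sm: "S [^] int m = \<one>" and Tn: "T [^] int n = \<one>"
    and indep: "\<And>a b. S [^] (a :: int) \<otimes> T [^] (b :: int) = \<one> \<Longrightarrow> int m dvd a \<and> int n dvd b"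
    and inf: "\<And>k. P [^] k = \<one> \<Longrightarrow> k = (0 :: int)"
  shows "contains_subgroup_iso G (integer_mod_group m \<times>\<times> integer_mod_group n \<times>\<times> integer_group)"
proof -
  let ?H = "integer_mod_group m \<times>\<times> integer_mod_group n \<times>\<times> integer_group"
  define f where "f = (\<lambda>(a :: int, b :: int, k :: int). S [^] a \<otimes> (T [^] b \<otimes> P [^] k))"
  have H: "group ?H"
    by (intro DirProd_group) simp_all
  have car: "carrier ?H = {0..<int m} \<times> {0..<int n} \<times> UNIV"
    using mn by (simp add: carrier_integer_mod_group)
  have mult: "(a, b, k) \<otimes>\<^bsub>?H\<^esub> (a', b', k') = ((a + a') mod int m, (b + b') mod int n, k + k')" for a b k a' b' k'
    by simp
  have hom: "f \<in> hom ?H G"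
  proof (rule homI)
    fix u v
    assume "u \<in> carrier ?H" "v \<in> carrier ?H"
    then show "f u \<in> carrier G"
      using S T P by (auto simp: f_def split: prod.splits)
    obtain a b k a' b' k' where uv: "u = (a, b, k)" "v = (a', b', k')"
      by (metis prod.exhaust)
    show "f (u \<otimes>\<^bsub>?H\<^esub> v) = f u \<otimes> f v"
      unfolding uv mult f_def prod.case
      using S T P by (simp add: int_pow_mod[OF S Sm] int_pow_mod[OF T Tn] int_pow_mult m_ac)
  qed
  interpret f: group_hom ?H G f
    using hom H by (simp add: group_hom_def group_hom_axioms_def is_group)
  have "inj_on f (carrier ?H)"
  proof (rule f.inj_on_one_iff[THEN iffD2], intro allI impI)
    fix u
    assume u: "u \<in> carrier ?H" and 1: "f u = \<one>"
    obtain a b k where abk: "u = (a, b, k)"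
      by (metis prod.exhaust)
    have eq: "S [^] a \<otimes> (T [^] b \<otimes> P [^] k) = \<one>"
      using 1 by (simp add: f_def abk)
    let ?N = "int m * int n"
    have "(S [^] a \<otimes> (T [^] b \<otimes> P [^] k)) [^] ?N = P [^] (k * ?N)"
    proof -
      have "S [^] (a * ?N) = \<one>"
      proof -
        have "S [^] (a * ?N) = (S [^] int m) [^] (a * int n)"
          using S by (simp only: int_pow_pow) (simp add: mult.left_commute mult.commute)
        then show ?thesis by (simp add: Sm)
      qed
      moreover have "T [^] (b * ?N) = \<one>"
      proof -
        have "T [^] (b * ?N) = (T [^] int n) [^] (b * int m)"
          using T by (simp only: int_pow_pow) (simp add: mult.left_commute mult.commute)
        then show ?thesis by (simp add: Tn)
      qed
      ultimately show ?thesis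
        using S T P by (simp add: int_pow_distrib int_pow_pow)
    qed
    then have "P [^] (k * ?N) = \<one>"
      by (simp only: eq int_pow_one)
    then have k: "k = 0"
      using inf mn by fastforce
    then have "S [^] a \<otimes> T [^] b = \<one>"
      using eq T by simp
    then have "int m dvd a" "int n dvd b"
      using indep by auto
    then have "a = 0" "b = 0"
      using u unfolding car abk by (auto intro: zdvd_not_zless dest: zdvd_imp_le)
    then show "u = \<one>\<^bsub>?H\<^esub>"
      by (simp add: abk k)
  qed
  moreover have "subgroup (f ` carrier ?H) G"
    by (rule f.img_is_subgroup)
  moreover have "f \<in> iso ?H (G\<lparr>carrier := f ` carrier ?H\<rparr>)"
    using calculation(1) hom by (auto simp: iso_def hom_def bij_betw_def)
  then have "G\<lparr>carrier := f ` carrier ?H\<rparr> \<cong> ?H"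
    using H group.iso_sym is_isoI by blast
  ultimately show ?thesis
    unfolding contains_subgroup_iso_def by blast
qed

lemma (in comm_group) contains_subgroup_iso_Zmod_Z:
  assumes T: "T \<in> carrier G" and P: "P \<in> carrier G" and n: "n > 0" and Tn: "T [^] int n = \<one>"
    and ord: "\<And>b. T [^] (b :: int) = \<one> \<Longrightarrow> int n dvd b"
    and inf: "\<And>k. P [^] k = \<one> \<Longrightarrow> k = (0 :: int)"
  shows "contains_subgroup_iso G (integer_mod_group n \<times>\<times> integer_group)"
proof -
  let ?H = "integer_mod_group n \<times>\<times> integer_group"
  let ?H1 = "integer_mod_group 1 \<times>\<times> ?H"
  have "contains_subgroup_iso G ?H1"
    by (rule contains_subgroup_iso_Zmod_Zmod_Z[OF one_closed T P]) (use n Tn ord inf T in auto)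
  then obtain U where U: "subgroup U G" "G\<lparr>carrier := U\<rparr> \<cong> ?H1"
    by (auto simp: contains_subgroup_iso_def)
  have "snd \<in> iso ?H1 ?H"
    by (auto simp: iso_def hom_def bij_betw_def inj_on_def carrier_integer_mod_group image_iff)
  then have "?H1 \<cong> ?H"
    by (rule is_isoI)
  with U show ?thesis
    unfolding contains_subgroup_iso_def using iso_trans by blast
qed

text \<open>If the order were a proper divisor of \<open>N\<close>, it would divide
  \<open>N div q\<close> for some prime \<open>q\<close>.\<close>

lemma (in group) int_pow_eq_one_imp_dvd:
  assumes x: "x \<in> carrier G" and N: "N > 0" "x [^] N = \<one>"
    and q: "\<And>q. prime q \<Longrightarrow> q dvd N \<Longrightarrow> x [^] (N div q) \<noteq> \<one>"
    and b: "x [^] (b :: int) = \<one>"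
  shows "int N dvd b"
proof -
  have "ord x dvd N"
    using x N pow_eq_id by blast
  then obtain k where k: "N = ord x * k" ..
  have "k = 1"
  proof (rule ccontr)
    assume "k \<noteq> 1"
    then obtain p where p: "prime p" "p dvd k"
      using prime_factor_nat by blast
    then have "ord x dvd N div p"
      using k by (auto simp: div_mult_swap[symmetric])
    then have "x [^] (N div p) = \<one>"
      using x pow_eq_id by blast
    then show False
      using q p k by auto
  qed
  then show ?thesis
    using b x k int_pow_eq_id by auto
qed

lemma (in group) int_pow_eq_one_imp_prime_dvd:
  assumes "x \<in> carrier G" "prime p" "x [^] p = \<one>" "x \<noteq> \<one>" "x [^] (b :: int) = \<one>"
  shows "int p dvd b"
proof (rule int_pow_eq_one_imp_dvd)
  fix q
  assume "prime q" "q dvd p"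
  then have "q = p"
    using assms(2) primes_dvd_imp_eq by blast
  then show "x [^] (p div q) \<noteq> \<one>"
    using assms prime_gt_0_nat[of p] by simp
qed (use assms prime_gt_0_nat in auto)

text \<open>Multiplying the relation by \<open>q\<close> leaves one for \<open>S\<close> alone, and
  multiplying by \<open>p\<close> one for \<open>T\<close> alone.\<close>

lemma (in comm_group) int_pow_mult_eq_one_imp_dvd:
  assumes S: "S \<in> carrier G" and T: "T \<in> carrier G" and pq: "prime p" "prime q" "p \<noteq> q"
    and Sp: "S [^] p = \<one>" "S \<noteq> \<one>" and Tq: "T [^] q = \<one>" "T \<noteq> \<one>"
    and b: "(S \<otimes> T) [^] (b :: int) = \<one>"
  shows "int (p * q) dvd b"
proof -
  have S0: "S [^] (k * int p) = \<one>" and T0: "T [^] (k * int q) = \<one>" for k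
    using S T Sp Tq by (simp_all add: mult.commute[of k] int_pow_int flip: int_pow_pow)
  have pow: "(S \<otimes> T) [^] (b * k) = \<one>" for k
    using b S T by (simp flip: int_pow_pow)
  have "S [^] (b * int q) = \<one>"
    using pow[of "int q"] S T T0[of b] by (simp add: int_pow_distrib)
  then have "int p dvd b * int q"
    using int_pow_eq_one_imp_prime_dvd S pq Sp by blast
  then have p: "int p dvd b"
    using pq by (simp add: prime_dvd_mult_iff) (metis primes_dvd_imp_eq)
  have "T [^] (b * int p) = \<one>"
    using pow[of "int p"] S T S0[of b] by (simp add: int_pow_distrib)
  then have "int q dvd b * int p"
    using int_pow_eq_one_imp_prime_dvd T pq Tq by blast
  then have q: "int q dvd b"
    using pq by (simp add: prime_dvd_mult_iff) (metis primes_dvd_imp_eq)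
  have "coprime (int p) (int q)"
    using pq primes_coprime[of "int p" "int q"] by simp
  then show ?thesis
    using divides_mult[OF p q] by simp
qed

text \<open>If \<open>p\<close> does not divide \<open>a\<close>, then \<open>a\<close> is
  invertible modulo \<open>p\<close> and the relation puts \<open>S\<close> into the cyclic group
  generated by \<open>T\<close>. Being killed by \<open>p\<close>, it is one of the \<open>p\<close>
  multiples of \<open>n T\<close>, so finitely many comparisons decide independence.\<close>

lemma (in comm_group) independent_of_prime_order:
  assumes S: "S \<in> carrier G" and T: "T \<in> carrier G" and p: "prime p" and Sp: "S [^] p = \<one>"
    and Tpn: "T [^] (p * n) = \<one>" and ord: "\<And>b. T [^] (b :: int) = \<one> \<Longrightarrow> int (p * n) dvd b"
    and notin: "\<And>c. c < p \<Longrightarrow> S \<noteq> T [^] (n * c)"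
    and ab: "S [^] (a :: int) \<otimes> T [^] (b :: int) = \<one>"
  shows "int p dvd a \<and> int (p * n) dvd b"
proof -
  have pS: "int p dvd a"
  proof (rule ccontr)
    assume "\<not> int p dvd a"
    then have "coprime a (int p)"
      using p prime_imp_coprime[of "int p" a] by (simp add: coprime_commute)
    then obtain a' k where a': "a * a' + int p * k = 1"
      using bezout_int[of a "int p"] by (auto simp: mult.commute)
    have "S = S [^] (a * a' + int p * k)"
      using S by (simp add: a')
    also have "\<dots> = (S [^] a) [^] a' \<otimes> (S [^] int p) [^] k"
      using S by (simp only: int_pow_mult int_pow_pow)
    also have "\<dots> = (S [^] a) [^] a'"
      using S Sp by (simp add: int_pow_int)
    also have "S [^] a = T [^] (- b)"
      using ab S T by (metis inv_equality int_pow_closed int_pow_neg)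
    finally have ST: "S = T [^] (- b * a')"
      using T by (simp only: int_pow_pow)
    have "T [^] (- b * a' * int p) = \<one>"
      using T Sp by (simp only: int_pow_pow[symmetric] ST[symmetric] int_pow_int)
    then have "int (p * n) dvd - b * a' * int p"
      by (rule ord)
    then have "int n dvd - b * a'"
      using p by (auto simp: mult.commute prime_gt_0_nat)
    then obtain c where c: "- b * a' = int n * c"
      by blast
    have "S = T [^] (int n * c)"
      using ST c by simp
    also have "\<dots> = T [^] (int n * (int p * (c div int p) + c mod int p))"
      by simp
    also have "\<dots> = (T [^] int (p * n)) [^] (c div int p) \<otimes> T [^] (int n * (c mod int p))"
      using T by (simp only: int_pow_pow distrib_left int_pow_mult[symmetric]) (simp add: mult_ac)
    also have "\<dots> = T [^] (int n * (c mod int p))"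
      using T Tpn by (simp only: int_pow_int int_pow_one l_one int_pow_closed)
    also have "int n * (c mod int p) = int (n * nat (c mod int p))"
      using p by (simp add: prime_gt_0_nat)
    finally have "S = T [^] (n * nat (c mod int p))"
      by (simp only: int_pow_int)
    moreover have "nat (c mod int p) < p"
      using p by (simp add: prime_gt_0_nat nat_less_iff)
    ultimately show False
      using notin by blast
  qed
  then have "S [^] a = \<one>"
  proof -
    obtain k where "a = int p * k" using pS ..
    then show ?thesis
      using S Sp by (simp only: int_pow_pow[symmetric] int_pow_int int_pow_one)
  qed
  then have "T [^] b = \<one>"
    using ab T by simp
  then show ?thesis
    using pS ord by blast
qed

text \<open>The prime case for \<open>p S\<close>, applied to \<open>p\<close> times the relation,
  gives \<open>a = p k\<close>. The original relation is then one between \<open>p S\<close> and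
  \<open>T\<close>, and a second application gives \<open>p dvd k\<close>.\<close>

lemma (in comm_group) independent_of_prime_square_order:
  assumes S: "S \<in> carrier G" and T: "T \<in> carrier G" and p: "prime p" and Sp: "S [^] (p * p) = \<one>"
    and Tpn: "T [^] (p * n) = \<one>" and ord: "\<And>b. T [^] (b :: int) = \<one> \<Longrightarrow> int (p * n) dvd b"
    and notin: "\<And>c. c < p \<Longrightarrow> S [^] p \<noteq> T [^] (n * c)"
    and ab: "S [^] (a :: int) \<otimes> T [^] (b :: int) = \<one>"
  shows "int (p * p) dvd a \<and> int (p * n) dvd b"
proof -
  have Spp: "(S [^] p) [^] p = \<one>"
    using S Sp by (simp add: nat_pow_pow)
  note indep = independent_of_prime_order[OF nat_pow_closed[OF S] T p Spp Tpn ord notin]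
  have pow: "(S [^] p) [^] k = S [^] (int p * k)" for k :: int
    using S by (simp add: int_pow_pow flip: int_pow_int)
  have "(S [^] p) [^] a \<otimes> T [^] (b * int p) = (S [^] a \<otimes> T [^] b) [^] int p"
    using S T by (simp add: pow int_pow_distrib int_pow_pow mult.commute)
  also have "\<dots> = \<one>"
    by (simp add: ab)
  finally obtain k where k: "a = int p * k"
    using indep by blast
  then have "(S [^] p) [^] k \<otimes> T [^] b = \<one>"
    using ab by (simp add: pow)
  then show ?thesis
    using indep k by auto
qed

section \<open>Points of infinite order\<close>

locale reduction_ideal =
  fixes R I :: "complex set"
  assumes R1: "1 \<in> R" and R_add: "x \<in> R \<Longrightarrow> y \<in> R \<Longrightarrow> x + y \<in> R"
    and R_mult: "x \<in> R \<Longrightarrow> y \<in> R \<Longrightarrow> x * y \<in> R" and R_uminus: "x \<in> R \<Longrightarrow> - x \<in> R"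
    and I_R: "x \<in> I \<Longrightarrow> x \<in> R" and I_add: "x \<in> I \<Longrightarrow> y \<in> I \<Longrightarrow> x + y \<in> I"
    and I_mult: "x \<in> R \<Longrightarrow> y \<in> I \<Longrightarrow> x * y \<in> I"
    and four: "4 \<in> I" and one: "1 \<notin> I"
begin

text \<open>Membership in \<open>1 + I\<close> takes the place of being a unit at the prime: it is
  preserved by products and incompatible with membership in \<open>I\<close>.\<close>

definition cong1 :: "complex \<Rightarrow> bool"
  where "cong1 x \<longleftrightarrow> x - 1 \<in> I"

lemma R_diff: "x \<in> R \<Longrightarrow> y \<in> R \<Longrightarrow> x - y \<in> R"
  using R_add[of x "- y"] R_uminus by simp

lemma R_numeral: "numeral n \<in> R"
  by (induction n) (use R1 R_add in \<open>simp_all only: numeral.simps\<close>)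

lemma R_power: "x \<in> R \<Longrightarrow> x ^ k \<in> R"
  by (induction k) (use R1 R_mult in auto)

lemmas R_closed = R1 R_add R_mult R_uminus R_diff R_numeral R_power

lemma I_mult': "y \<in> I \<Longrightarrow> x \<in> R \<Longrightarrow> y * x \<in> I"
  using I_mult[of x y] by (simp add: mult.commute)

lemma I_uminus: "x \<in> I \<Longrightarrow> - x \<in> I"
  using I_mult[of "- 1" x] R1 R_uminus by simp

lemma I_diff: "x \<in> I \<Longrightarrow> y \<in> I \<Longrightarrow> x - y \<in> I"
  using I_add[of x "- y"] I_uminus by simp

lemma cong1_R: "cong1 x \<Longrightarrow> x \<in> R"
  unfolding cong1_def using I_R[of "x - 1"] R_add[of "x - 1" 1] R1 by simp

lemma cong1_mult: "cong1 x \<Longrightarrow> cong1 y \<Longrightarrow> cong1 (x * y)"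
  using I_add[OF I_mult[OF cong1_R[of x], of "y - 1"], of "x - 1"]
  by (auto simp: cong1_def algebra_simps)

lemma cong1_1: "cong1 1"
  using I_diff[OF four four] by (simp add: cong1_def)

lemma cong1_power: "cong1 x \<Longrightarrow> cong1 (x ^ k)"
  by (induction k) (auto simp: cong1_1 intro: cong1_mult)

lemma cong1_add: "cong1 x \<Longrightarrow> y \<in> I \<Longrightarrow> cong1 (x + y)"
  using I_add[of "x - 1" y] by (simp add: cong1_def algebra_simps)

lemma cong1_not_I: "cong1 x \<Longrightarrow> x \<notin> I"
  using I_diff[of x "x - 1"] one by (auto simp: cong1_def)

text \<open>Clearing denominators in \<open>t\<^sup>2 = 4 x ^ 3 + b2 x\<^sup>2 + 2 b4 x + b6\<close>
  gives \<open>4 U\<close>; it is the 4 in the denominator \<open>4 n\<close> that lets this factor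
  be taken out with \<open>U\<close> still in \<open>1 + I\<close>. The numerator of
  \<open>x(2 P)\<close> is \<open>x ^ 4 - b4 x\<^sup>2 - 2 b6 x - b8\<close>, which becomes
  \<open>D ^ 4\<close> modulo \<open>I\<close>.\<close>

lemma double_near_infinity:
  assumes E: "E = Weierstrass a1 a2 a3 a4 a6" "set_weierstrass E \<subseteq> R"
    and on: "on_curve E (Affine_point x y)"
    and x: "x * (4 * n) = D" "n \<in> I" "cong1 D"
  obtains x' y' U D' where "point_add E (Affine_point x y) (Affine_point x y) = Affine_point x' y'"
    and "x' * (4 * U * (4 * n)) = D'" and "cong1 U" and "cong1 D'"
proof -
  have a: "a1 \<in> R" "a2 \<in> R" "a3 \<in> R" "a4 \<in> R" "a6 \<in> R"
    using E by auto
  have nR: "n \<in> R" and DR: "D \<in> R"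
    using x I_R cong1_R by auto
  define b2 b4 b6 b8 where b: "b2 = a1\<^sup>2 + 4 * a2" "b4 = 2 * a4 + a1 * a3" "b6 = a3\<^sup>2 + 4 * a6"
    "b8 = a1\<^sup>2 * a6 + 4 * a2 * a6 - a1 * a3 * a4 + a2 * a3\<^sup>2 - a4\<^sup>2"
  have bR: "b2 \<in> R" "b4 \<in> R" "b6 \<in> R" "b8 \<in> R"
    using a by (auto simp: b intro!: R_closed)
  define t where "t = 2 * y + a1 * x + a3"
  define U where "U = D ^ 3 + n * (b2 * D\<^sup>2 + 8 * b4 * D * n + 16 * b6 * n\<^sup>2)"
  define D' where "D' = D ^ 4 + n * (- 16 * b4 * D\<^sup>2 * n - 128 * b6 * D * n\<^sup>2 - 256 * b8 * n ^ 3)"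
  have U: "cong1 U" unfolding U_def
    by (intro cong1_add cong1_power I_mult' x R_closed bR DR nR)
  have D': "cong1 D'" unfolding D'_def
    by (intro cong1_add cong1_power I_mult' x R_closed bR DR nR)
  have on': "y\<^sup>2 + a1 * x * y + a3 * y = x ^ 3 + a2 * x\<^sup>2 + a4 * x + a6"
    using on by (simp add: E)
  have t2: "t\<^sup>2 = 4 * x ^ 3 + b2 * x\<^sup>2 + 2 * b4 * x + b6"
    using on' unfolding t_def b by Groebner_Basis.algebra
  have tU: "t\<^sup>2 * (4 * n) ^ 3 = 4 * U"
    unfolding t2 U_def x(1)[symmetric] by Groebner_Basis.algebra
  \<comment> \<open>As \<open>0 \<in> I\<close> and \<open>U \<notin> I\<close>, \<open>U\<close> is
    nonzero. Hence the tangent is not vertical.\<close>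
  have "4 * U \<noteq> 0"
    using cong1_not_I[OF U] I_mult[of 0 4] R_diff[OF R1 R1] four by auto
  then have t0: "t \<noteq> 0"
    using tU by auto
  define l where "l = (3 * x\<^sup>2 + 2 * a2 * x + a4 - a1 * y) / t"
  have l: "l * t = 3 * x\<^sup>2 + 2 * a2 * x + a4 - a1 * y"
    using t0 by (simp add: l_def)
  define x' where "x' = l\<^sup>2 + a1 * l - a2 - 2 * x"
  have "x' * t\<^sup>2 = (l * t)\<^sup>2 + a1 * (l * t) * t - (a2 + 2 * x) * t\<^sup>2"
    unfolding x'_def by Groebner_Basis.algebra
  also have "\<dots> = x ^ 4 - b4 * x\<^sup>2 - 2 * b6 * x - b8"
    unfolding l unfolding t_def b using on' by Groebner_Basis.algebra
  finally have x't: "x' * t\<^sup>2 = x ^ 4 - b4 * x\<^sup>2 - 2 * b6 * x - b8" .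
  have "x' * t\<^sup>2 * (4 * n) ^ 4 = D'"
    unfolding D'_def x(1)[symmetric] x't by Groebner_Basis.algebra
  moreover have "x' * (4 * U * (4 * n)) = x' * t\<^sup>2 * (4 * n) ^ 4"
    unfolding tU[symmetric] by Groebner_Basis.algebra
  ultimately have "x' * (4 * U * (4 * n)) = D'"
    by simp
  moreover have "point_add E (Affine_point x y) (Affine_point x y)
      = Affine_point x' (- (y + l * (x' - x)) - a1 * x' - a3)"
    unfolding E by (rule point_add_double[where l = l]) (use t0 l in \<open>auto simp: t_def x'_def\<close>)
  ultimately show ?thesis
    using that U D' by blast
qed

lemma infinite_order:
  assumes K: "subfield K ring_of_type_algebra" and EK: "elliptic_curve_over K E"
    and ER: "set_weierstrass E \<subseteq> R"
    and P: "Affine_point x y \<in> carrier (mordell_weil_group K E)"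
    and x: "x * (4 * n) = D" "n \<in> I" "cong1 D"
    and k: "Affine_point x y [^]\<^bsub>mordell_weil_group K E\<^esub> k = \<one>\<^bsub>mordell_weil_group K E\<^esub>"
  shows "k = (0 :: int)"
proof (rule ccontr)
  assume k0: "k \<noteq> 0"
  let ?G = "mordell_weil_group K E"
  let ?P = "Affine_point x y"
  interpret G: comm_group ?G
    using K EK by (rule comm_group_mordell_weil)
  have dbl: "?P [^]\<^bsub>?G\<^esub> (2 ^ Suc j :: nat) = point_add E (?P [^]\<^bsub>?G\<^esub> (2 ^ j :: nat)) (?P [^]\<^bsub>?G\<^esub> (2 ^ j :: nat))" for j
    using mordell_weil_pow_double[OF K EK P, of "2 ^ j"] by simp
  have onc: "on_curve E Q" if "Q \<in> carrier ?G" for Q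
    using that by simp
  have near: "\<exists>x' y' U D'. ?P [^]\<^bsub>?G\<^esub> (2 ^ j :: nat) = Affine_point x' y' \<and> x' * (4 ^ j * U * (4 * n)) = D' \<and> cong1 U \<and> cong1 D'" for j
  proof (induction j)
    case 0
    show ?case
      using x P by (intro exI[of _ x] exI[of _ y] exI[of _ 1] exI[of _ D]) (auto simp: cong1_1)
  next
    case (Suc j)
    then obtain x' y' U D' where IH: "?P [^]\<^bsub>?G\<^esub> (2 ^ j :: nat) = Affine_point x' y'"
      "x' * (4 * (4 ^ j * U * n)) = D'" "cong1 U" "cong1 D'"
      by (auto simp: mult_ac)
    obtain a1 a2 a3 a4 a6 where E: "E = Weierstrass a1 a2 a3 a4 a6" by (cases E)
    \<comment> \<open>In the next doubling this product takes the place of \<open>n\<close>.\<close>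
    have "4 ^ j * U * n \<in> I"
      using x(2) IH(3) by (intro I_mult R_closed cong1_R)
    moreover have "on_curve E (Affine_point x' y')"
      using onc[OF G.nat_pow_closed[OF P]] IH(1) by metis
    ultimately obtain x'' y'' V D'' where "point_add E (Affine_point x' y') (Affine_point x' y') = Affine_point x'' y''"
      "x'' * (4 * V * (4 * (4 ^ j * U * n))) = D''" "cong1 V" "cong1 D''"
      using double_near_infinity[OF E ER _ IH(2)] IH(4) by metis
    then show ?case
      using IH dbl[of j]
      by (intro exI[of _ x''] exI[of _ y''] exI[of _ "V * U"] exI[of _ D'']) (auto simp: cong1_mult mult_ac)
  qed
  let ?f = "\<lambda>j. ?P [^]\<^bsub>?G\<^esub> (2 ^ j :: nat)"
  define m where "m = nat \<bar>k\<bar>"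
  have m: "m > 0" "?P [^]\<^bsub>?G\<^esub> m = \<one>\<^bsub>?G\<^esub>"
  proof -
    have "?P [^]\<^bsub>?G\<^esub> \<bar>k\<bar> = \<one>\<^bsub>?G\<^esub>"
      using k G.int_pow_neg[OF P, of k] by (cases "k \<ge> 0") (auto simp del: mordell_weil_simps)
    then show "?P [^]\<^bsub>?G\<^esub> m = \<one>\<^bsub>?G\<^esub>"
      by (simp add: m_def flip: int_pow_int)
  qed (use k0 in \<open>simp add: m_def\<close>)
  have "range ?f \<subseteq> (\<lambda>i. ?P [^]\<^bsub>?G\<^esub> i) ` {..<m}"
  proof clarify
    fix j
    have "?f j = ?P [^]\<^bsub>?G\<^esub> (m * (2 ^ j div m) + 2 ^ j mod m)"
      by simp
    also have "\<dots> = ?P [^]\<^bsub>?G\<^esub> (2 ^ j mod m)"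
      using P m(2) by (simp only: G.nat_pow_mult[symmetric] G.nat_pow_pow[symmetric] G.nat_pow_one G.l_one G.nat_pow_closed)
    finally show "?f j \<in> (\<lambda>i. ?P [^]\<^bsub>?G\<^esub> i) ` {..<m}"
      using m(1) by simp
  qed
  then have "finite (range ?f)"
    using finite_subset by blast
  then have "\<not> inj ?f"
    using finite_imageD infinite_UNIV_nat by blast
  then obtain i j where ij: "i < j" "?f i = ?f j"
    unfolding inj_def by (metis linorder_neqE_nat)
  obtain x1 y1 U1 D1 where 1: "?f i = Affine_point x1 y1" "x1 * (4 ^ i * U1 * (4 * n)) = D1" "cong1 U1" "cong1 D1"
    using near by blast
  obtain x2 y2 U2 D2 where 2: "?f j = Affine_point x2 y2" "x2 * (4 ^ j * U2 * (4 * n)) = D2" "cong1 U2" "cong1 D2"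
    using near by blast
  have "x2 = x1"
    using 1(1) 2(1) ij(2) by simp
  have pw: "4 ^ j = (4 :: complex) ^ (j - i) * 4 ^ i"
    using ij(1) by (simp flip: power_add)
  have "U1 * D2 = 4 ^ (j - i) * U2 * D1"
    unfolding 1(2)[symmetric] 2(2)[symmetric] \<open>x2 = x1\<close> pw by Groebner_Basis.algebra
  also have "\<dots> = 4 * (4 ^ (j - i - 1) * U2 * D1)"
    using ij(1) by (cases "j - i") auto
  also have "\<dots> \<in> I"
    by (intro I_mult' four R_closed cong1_R 1 2)
  finally show False
    using cong1_not_I cong1_mult 1 2 by blast
qed

end

section \<open>Quartic fields\<close>

definition rat_span :: "complex \<Rightarrow> complex \<Rightarrow> complex \<Rightarrow> complex set"
  where "rat_span u v w = {of_rat a + of_rat b * u + of_rat c * v + of_rat d * w | a b c d. True}"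

lemma subfield_Rats: "subfield \<rat> (ring_of_type_algebra :: complex ring)"
proof -
  interpret R: field "ring_of_type_algebra :: complex ring" ..
  have "subring \<rat> (ring_of_type_algebra :: complex ring)"
    by (rule R.subringI) (auto simp: type_algebra_ops)
  moreover have "inv\<^bsub>ring_of_type_algebra\<^esub> x \<in> \<rat>" if "x \<in> \<rat> - {0}" for x :: complex
  proof -
    have "inv\<^bsub>ring_of_type_algebra\<^esub> x = inverse x"
      by (rule R.comm_inv_char) (use that in \<open>simp_all add: ring_of_type_algebra_def\<close>)
    then show ?thesis
      using that by simp
  qed
  ultimately show ?thesis
    by (intro R.subfieldI') (auto simp: ring_of_type_algebra_def)
qed

text \<open>By finite dimension each element of \<open>F\<close> is algebraic, so its inverse
  already lies in the ring it generates over \<rat>.\<close>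

lemma finite_dimension_subring_imp_subfield:
  assumes F: "subring F (ring_of_type_algebra :: complex ring)"
    and dim: "ring.finite_dimension ring_of_type_algebra \<rat> F" and "\<rat> \<subseteq> F"
  shows "subfield F ring_of_type_algebra"
proof -
  interpret R: field "ring_of_type_algebra :: complex ring" ..
  have "inv\<^bsub>ring_of_type_algebra\<^esub> x \<in> F" if x: "x \<in> F - {0}" for x
  proof -
    have alg: "(R.algebraic over \<rat>) x"
      using R.finite_dimension_imp_algebraic[OF subfield_Rats F dim] x by simp
    have "subfield (R.simple_extension \<rat> x) ring_of_type_algebra"
      using alg R.simple_extension_is_subfield[OF subfield_Rats] by (simp add: ring_of_type_algebra_def)
    moreover have "x \<in> R.simple_extension \<rat> x"
      using R.simple_extension_mem[OF subfieldE(1)[OF subfield_Rats]] by (simp add: ring_of_type_algebra_def)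
    ultimately have "inv\<^bsub>ring_of_type_algebra\<^esub> x \<in> R.simple_extension \<rat> x"
      using R.subfield_m_inv(1) x by (simp add: ring_of_type_algebra_def)
    moreover have "R.simple_extension \<rat> x \<subseteq> F"
      using R.simple_extension_subring_incl[OF F \<open>\<rat> \<subseteq> F\<close>] x by simp
    ultimately show ?thesis
      by blast
  qed
  then show ?thesis
    using F by (intro R.subfieldI') (auto simp: ring_of_type_algebra_def)
qed

lemma number_field_rat_span:
  assumes prod: "u * u \<in> rat_span u v w" "u * v \<in> rat_span u v w" "u * w \<in> rat_span u v w"
      "v * v \<in> rat_span u v w" "v * w \<in> rat_span u v w" "w * w \<in> rat_span u v w"
    and indep: "\<And>a b c d. of_rat a + of_rat b * u + of_rat c * v + of_rat d * w = 0
      \<Longrightarrow> a = 0 \<and> b = 0 \<and> c = 0 \<and> d = 0"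
  shows "number_field_of_degree 4 (rat_span u v w)"
proof -
  interpret R: field "ring_of_type_algebra :: complex ring" ..
  let ?S = "rat_span u v w"
  have I: "of_rat a + of_rat b * u + of_rat c * v + of_rat d * w \<in> ?S" for a b c d
    unfolding rat_span_def by blast
  have add: "x + y \<in> ?S" if xy: "x \<in> ?S" "y \<in> ?S" for x y
  proof -
    from xy obtain a b c d a' b' c' d' where
      "x = of_rat a + of_rat b * u + of_rat c * v + of_rat d * w"
      "y = of_rat a' + of_rat b' * u + of_rat c' * v + of_rat d' * w"
      unfolding rat_span_def by blast
    then have "x + y = of_rat (a + a') + of_rat (b + b') * u + of_rat (c + c') * v + of_rat (d + d') * w"
      by (simp add: of_rat_add algebra_simps)
    then show ?thesis
      using I by metis
  qed
  have scale: "of_rat q * x \<in> ?S" if x: "x \<in> ?S" for q x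
  proof -
    from x obtain a b c d where "x = of_rat a + of_rat b * u + of_rat c * v + of_rat d * w"
      unfolding rat_span_def by blast
    then have "of_rat q * x = of_rat (q * a) + of_rat (q * b) * u + of_rat (q * c) * v + of_rat (q * d) * w"
      by (simp add: of_rat_mult algebra_simps)
    then show ?thesis
      using I by metis
  qed
  have gens: "1 \<in> ?S" "u \<in> ?S" "v \<in> ?S" "w \<in> ?S"
    using I[of 1 0 0 0] I[of 0 1 0 0] I[of 0 0 1 0] I[of 0 0 0 1] by simp_all
  have mult: "x * y \<in> ?S" if xy: "x \<in> ?S" "y \<in> ?S" for x y
  proof -
    have lin: "(\<And>z. z \<in> {1, u, v, w} \<Longrightarrow> t * z \<in> ?S) \<Longrightarrow> y' \<in> ?S \<Longrightarrow> t * y' \<in> ?S" for t y'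
    proof -
      assume t: "\<And>z. z \<in> {1, u, v, w} \<Longrightarrow> t * z \<in> ?S" and "y' \<in> ?S"
      then obtain a b c d where "y' = of_rat a + of_rat b * u + of_rat c * v + of_rat d * w"
        unfolding rat_span_def by blast
      then have y: "t * y' = of_rat a * (t * 1) + of_rat b * (t * u) + of_rat c * (t * v) + of_rat d * (t * w)"
        by (simp add: algebra_simps)
      show "t * y' \<in> ?S"
        unfolding y by (intro add scale t) auto
    qed
    have "y * z \<in> ?S" if "z \<in> {1, u, v, w}" for z
    proof -
      have "z * y \<in> ?S"
        by (rule lin) (use that prod gens xy in \<open>auto simp: mult.commute\<close>)
      then show ?thesis
        by (simp add: mult.commute)
    qed
    then have "y * x \<in> ?S"
      using lin xy by blast
    then show ?thesis
      by (simp add: mult.commute)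
  qed
  have "subring ?S (ring_of_type_algebra :: complex ring)"
    using scale[of _ "-1"] add mult gens
    by (intro R.subringI) (auto simp: type_algebra_ops)
  moreover have dim: "R.dimension 4 \<rat> ?S"
  proof -
    have le: "R.line_extension \<rat> z E = {of_rat q * z + e | q e. e \<in> E}" for z E
      unfolding R.line_extension_def r_coset_def set_add_def' Rats_def by (auto simp: ring_of_type_algebra_def)
    have step: "R.dimension (Suc k) \<rat> {of_rat q * z + e | q e. e \<in> E}"
      if "R.dimension k \<rat> E" "z \<notin> E" for k z E
      using R.dimension.Suc_dim[OF _ that(2,1)] by (simp add: le type_algebra_ops)
    \<comment> \<open>The basis is adjoined in the order \<open>w\<close>, \<open>v\<close>,
      \<open>u\<close>, 1, so that the nested sums take the shape of
      \<open>rat_span\<close>.\<close>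
    have 0: "R.dimension 0 \<rat> {0}"
      using R.dimension.zero_dim[of \<rat>] by (simp add: type_algebra_ops)
    have "w \<notin> {0}"
      using indep[of 0 0 0 1] by auto
    note 1 = step[OF 0 this]
    have eq1: "{of_rat d * w + e | d e. e \<in> {0}} = {of_rat d * w | d. True}"
      by simp
    have "v \<noteq> of_rat d * w" for d
      using indep[of 0 0 "-1" d] by (auto simp: of_rat_minus)
    then have "v \<notin> {of_rat d * w | d. True}"
      by blast
    note 2 = step[OF 1[unfolded eq1] this]
    have eq2: "{of_rat c * v + e | c e. e \<in> {of_rat d * w | d. True}} = {of_rat c * v + of_rat d * w | c d. True}"
      by blast
    have "u \<noteq> of_rat c * v + of_rat d * w" for c d
      using indep[of 0 "-1" c d] by (auto simp: of_rat_minus)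
    then have "u \<notin> {of_rat c * v + of_rat d * w | c d. True}"
      by blast
    note 3 = step[OF 2[unfolded eq2] this]
    have eq3: "{of_rat b * u + e | b e. e \<in> {of_rat c * v + of_rat d * w | c d. True}}
        = {of_rat b * u + (of_rat c * v + of_rat d * w) | b c d. True}"
      by blast
    have "1 \<noteq> of_rat b * u + (of_rat c * v + of_rat d * w)" for b c d
      using indep[of "-1" b c d] by (auto simp: of_rat_minus algebra_simps)
    then have "1 \<notin> {of_rat b * u + (of_rat c * v + of_rat d * w) | b c d. True}"
      by blast
    note 4 = step[OF 3[unfolded eq3] this]
    have "{of_rat a * 1 + e | a e. e \<in> {of_rat b * u + (of_rat c * v + of_rat d * w) | b c d. True}} = ?S"
      unfolding rat_span_def by (simp add: add.assoc) blast
    with 4 show ?thesis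
      by (simp add: numeral_eq_Suc)
  qed
  moreover have "\<rat> \<subseteq> ?S"
    using scale[OF gens(1)] by (auto simp: Rats_def)
  ultimately show ?thesis
    unfolding number_field_of_degree_def
    using finite_dimension_subring_imp_subfield R.finite_dimensionI by blast
qed

text \<open>An opaque wrapper for coordinates: the rules combine two vectors into one without
  exposing \<open>u\<close>, \<open>v\<close>, \<open>w\<close>, so that the simplifier evaluates
  field arithmetic as rational arithmetic.\<close>

definition lin4 :: "complex \<Rightarrow> complex \<Rightarrow> complex \<Rightarrow> complex \<Rightarrow> complex \<Rightarrow> complex \<Rightarrow> complex \<Rightarrow> complex"
  where "lin4 u v w a b c d = a + b * u + c * v + d * w"

lemma lin4_add: "lin4 u v w a b c d + lin4 u v w a' b' c' d' = lin4 u v w (a + a') (b + b') (c + c') (d + d')"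
  and lin4_diff: "lin4 u v w a b c d - lin4 u v w a' b' c' d' = lin4 u v w (a - a') (b - b') (c - c') (d - d')"
  and lin4_uminus: "- lin4 u v w a b c d = lin4 u v w (- a) (- b) (- c) (- d)"
  and lin4_numeral: "numeral n * lin4 u v w a b c d = lin4 u v w (numeral n * a) (numeral n * b) (numeral n * c) (numeral n * d)"
  by (simp_all add: lin4_def algebra_simps)

text \<open>Stated as an equivalence so that the simplifier does not replace \<open>lin4 u v w 1 0 0 0\<close> by \<open>1\<close> inside
  sums, where the other rules would no longer apply.\<close>

lemma lin4_one: "lin4 u v w 1 0 0 0 = 1 \<longleftrightarrow> True"
  by (simp add: lin4_def)

lemma lin4_zero: "lin4 u v w 0 0 0 0 = 0"
  by (simp add: lin4_def)

lemmas lin4_simps = lin4_add lin4_diff lin4_uminus lin4_numeral lin4_one lin4_zero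

definition even_span :: "complex \<Rightarrow> complex \<Rightarrow> complex \<Rightarrow> complex set"
  where "even_span u v w = {lin4 u v w (of_int (2 * a)) (of_int b) (of_int c) (of_int d) | a b c d. True}"

definition int_span :: "complex \<Rightarrow> complex \<Rightarrow> complex \<Rightarrow> complex set"
  where "int_span u v w = {lin4 u v w (of_int a) (of_int b) (of_int c) (of_int d) | a b c d. True}"

text \<open>The products lie in the even span, so the parity of the constant coefficient is a ring
  homomorphism from the integral span onto the field with two elements, that is, reduction modulo
  a prime above 2.\<close>

locale even_quartic_basis =
  fixes u v w :: complex
  assumes products: "u * u \<in> even_span u v w" "u * v \<in> even_span u v w" "u * w \<in> even_span u v w"
      "v * v \<in> even_span u v w" "v * w \<in> even_span u v w" "w * w \<in> even_span u v w"
    and indep: "of_rat a + of_rat b * u + of_rat c * v + of_rat d * w = 0 \<Longrightarrow> a = 0 \<and> b = 0 \<and> c = 0 \<and> d = 0"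
begin

lemma number_field: "number_field_of_degree 4 (rat_span u v w)"
proof (rule number_field_rat_span)
  have "even_span u v w \<subseteq> rat_span u v w"
  proof
    fix x
    assume "x \<in> even_span u v w"
    then obtain a b c d :: int where "x = of_int (2 * a) + of_int b * u + of_int c * v + of_int d * w"
      unfolding even_span_def lin4_def by blast
    then have "x = of_rat (of_int (2 * a)) + of_rat (of_int b) * u + of_rat (of_int c) * v + of_rat (of_int d) * w"
      by (simp only: of_rat_of_int_eq)
    then show "x \<in> rat_span u v w"
      unfolding rat_span_def by blast
  qed
  then show "u * u \<in> rat_span u v w" "u * v \<in> rat_span u v w" "u * w \<in> rat_span u v w"
      "v * v \<in> rat_span u v w" "v * w \<in> rat_span u v w" "w * w \<in> rat_span u v w"
    using products by auto
qed (rule indep)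

lemma subfield: "subfield (rat_span u v w) ring_of_type_algebra"
  using number_field by (simp add: number_field_of_degree_def)

lemma lin4_rat_span:
  assumes "a \<in> \<rat>" "b \<in> \<rat>" "c \<in> \<rat>" "d \<in> \<rat>"
  shows "lin4 u v w a b c d \<in> rat_span u v w"
  using assms unfolding rat_span_def lin4_def Rats_def by blast

lemma lin4_int_span:
  assumes "a \<in> \<int>" "b \<in> \<int>" "c \<in> \<int>" "d \<in> \<int>"
  shows "lin4 u v w a b c d \<in> int_span u v w"
  using assms unfolding int_span_def Ints_def by blast

lemma lin4_even_span:
  assumes "a / 2 \<in> \<int>" "b \<in> \<int>" "c \<in> \<int>" "d \<in> \<int>"
  shows "lin4 u v w a b c d \<in> even_span u v w"
proof -
  obtain k where "a = of_int (2 * k)"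
    using assms(1) by (auto elim!: Ints_cases simp: field_simps)
  then show ?thesis
    using assms(2-4) unfolding even_span_def Ints_def by blast
qed

lemma lin4_eq_0_iff:
  assumes "a \<in> \<rat>" "b \<in> \<rat>" "c \<in> \<rat>" "d \<in> \<rat>"
  shows "lin4 u v w a b c d = 0 \<longleftrightarrow> a = 0 \<and> b = 0 \<and> c = 0 \<and> d = 0"
proof -
  obtain a' b' c' d' where "a = of_rat a'" "b = of_rat b'" "c = of_rat c'" "d = of_rat d'"
    using assms by (metis Rats_cases)
  then show ?thesis
    using indep[of a' b' c' d'] by (auto simp: lin4_def)
qed

lemma lin4_eq_iff:
  assumes "a \<in> \<rat>" "b \<in> \<rat>" "c \<in> \<rat>" "d \<in> \<rat>" "a' \<in> \<rat>" "b' \<in> \<rat>" "c' \<in> \<rat>" "d' \<in> \<rat>"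
  shows "lin4 u v w a b c d = lin4 u v w a' b' c' d' \<longleftrightarrow> a = a' \<and> b = b' \<and> c = c' \<and> d = d'"
  using lin4_eq_0_iff[of "a - a'" "b - b'" "c - c'" "d - d'"] assms by (auto simp flip: lin4_diff)

lemma reduction_ideal: "reduction_ideal (int_span u v w) (even_span u v w)"
proof
  let ?R = "int_span u v w" and ?I = "even_span u v w" and ?L = "lin4 u v w"
  have RI: "?L (of_int a) (of_int b) (of_int c) (of_int d) \<in> ?R" for a b c d
    unfolding int_span_def by blast
  have II: "?L (of_int (2 * a)) (of_int b) (of_int c) (of_int d) \<in> ?I" for a b c d
    unfolding even_span_def by blast
  have RE: "\<exists>a b c d. x = ?L (of_int a) (of_int b) (of_int c) (of_int d)" if "x \<in> ?R" for x
    using that unfolding int_span_def by blast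
  have IE: "\<exists>a b c d. x = ?L (of_int (2 * a)) (of_int b) (of_int c) (of_int d)" if "x \<in> ?I" for x
    using that unfolding even_span_def by blast
  show "1 \<in> ?R"
    using RI[of 1 0 0 0] by (simp add: lin4_def)
  show Radd: "x + y \<in> ?R" if "x \<in> ?R" "y \<in> ?R" for x y
    using RE[OF that(1)] RE[OF that(2)] RI by (auto simp: lin4_add simp flip: of_int_add)
  show "- x \<in> ?R" if "x \<in> ?R" for x
    using RE[OF that] RI by (auto simp: lin4_uminus simp flip: of_int_minus)
  show IR: "x \<in> ?R" if "x \<in> ?I" for x
    using IE[OF that] RI by blast
  show Iadd: "x + y \<in> ?I" if "x \<in> ?I" "y \<in> ?I" for x y
    using IE[OF that(1)] IE[OF that(2)] II
    by (auto simp: lin4_add simp flip: of_int_add distrib_left)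
  show "4 \<in> ?I"
    using II[of 2 0 0 0] by (simp add: lin4_def)
  show "1 \<notin> ?I"
  proof
    assume "1 \<in> ?I"
    then obtain a b c d where "1 = ?L (of_int (2 * a)) (of_int b) (of_int c) (of_int d)"
      using IE by blast
    then have "of_rat (of_int (2 * a - 1)) + of_rat (of_int b) * u + of_rat (of_int c) * v + of_rat (of_int d) * w = 0"
      by (simp add: lin4_def of_rat_diff of_rat_mult algebra_simps)
    from indep[OF this] show False
      by (simp only: of_int_eq_0_iff) presburger
  qed
  have scale: "of_int k * x \<in> ?I" if x: "x \<in> ?I" for k x
  proof -
    obtain a b c d where "x = ?L (of_int (2 * a)) (of_int b) (of_int c) (of_int d)"
      using IE x by blast
    then have "of_int k * x = ?L (of_int (2 * (k * a))) (of_int (k * b)) (of_int (k * c)) (of_int (k * d))"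
      by (simp add: lin4_def algebra_simps)
    then show ?thesis
      using II by metis
  qed
  have gens: "u \<in> ?I" "v \<in> ?I" "w \<in> ?I"
    using II[of 0 1 0 0] II[of 0 0 1 0] II[of 0 0 0 1] by (simp_all add: lin4_def)
  have 2: "of_int (2 * a) \<in> ?I" for a
    using II[of a 0 0 0] by (simp add: lin4_def)
  show Imult: "x * y \<in> ?I" if xy: "x \<in> ?R" "y \<in> ?I" for x y
  proof -
    have gen: "t * y \<in> ?I" if "t \<in> {u, v, w}" for t
    proof -
      obtain a b c d where y: "y = ?L (of_int (2 * a)) (of_int b) (of_int c) (of_int d)"
        using IE xy by blast
      have "t * y = of_int (2 * a) * t + of_int b * (t * u) + of_int c * (t * v) + of_int d * (t * w)"
        by (simp add: y lin4_def algebra_simps)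
      moreover have "t * u \<in> ?I" "t * v \<in> ?I" "t * w \<in> ?I" "t \<in> ?I"
        using that products gens by (auto simp: mult.commute)
      ultimately show ?thesis
        by (simp only:) (intro Iadd scale)
    qed
    obtain a b c d where x: "x = ?L (of_int a) (of_int b) (of_int c) (of_int d)"
      using RE xy by blast
    have "x * y = of_int a * y + of_int b * (u * y) + of_int c * (v * y) + of_int d * (w * y)"
      by (simp add: x lin4_def algebra_simps)
    then show ?thesis
      using gen xy(2) by (simp only:) (intro Iadd scale, auto)
  qed
  show "x * y \<in> ?R" if xy: "x \<in> ?R" "y \<in> ?R" for x y
  proof -
    obtain a b c d where y: "y = ?L (of_int a) (of_int b) (of_int c) (of_int d)"
      using RE xy by blast
    \<comment> \<open>\<open>y\<close> is an integer plus an element of \<open>I\<close>, so closure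
      of \<open>R\<close> under products follows because \<open>I\<close> absorbs
      \<open>R\<close>.\<close>
    have "x * y = of_int a * x + x * ?L (of_int (2 * 0)) (of_int b) (of_int c) (of_int d)"
      by (simp add: y lin4_def algebra_simps)
    moreover have "of_int a * x \<in> ?R"
    proof -
      obtain a' b' c' d' where "x = ?L (of_int a') (of_int b') (of_int c') (of_int d')"
        using RE xy by blast
      then have "of_int a * x = ?L (of_int (a * a')) (of_int (a * b')) (of_int (a * c')) (of_int (a * d'))"
        by (simp add: lin4_def algebra_simps)
      then show ?thesis
        using RI by metis
    qed
    ultimately show ?thesis
      using Radd IR Imult[OF xy(1) II] by metis
  qed
qed

sublocale reduction_ideal "int_span u v w" "even_span u v w"
  by (rule reduction_ideal)

lemma cong1_lin4:
  assumes "(a - 1) / 2 \<in> \<int>" "b \<in> \<int>" "c \<in> \<int>" "d \<in> \<int>"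
  shows "cong1 (lin4 u v w a b c d)"
proof -
  have "lin4 u v w a b c d - 1 = lin4 u v w (a - 1) b c d"
    by (simp add: lin4_def)
  then show ?thesis
    using lin4_even_span[OF assms] by (simp add: cong1_def)
qed

end

section \<open>Towers of two quadratic extensions\<close>

lemma lin4_mult_tower:
  fixes r u :: complex
  assumes r: "r * r = A + B * r" and u: "u * u = C + D * r + (F + G * r) * u"
  defines "L \<equiv> lin4 r u (r * u)"
  shows "L a b c d * L a' b' c' d' =
    (let g = c * c' + A * d * d'; h = c * d' + c' * d + B * d * d' in
     L (a * a' + A * b * b' + g * C + A * h * D)
       (a * b' + a' * b + B * b * b' + g * D + h * C + B * h * D)
       (a * c' + a' * c + A * (b * d' + b' * d) + g * F + A * h * G)
       (a * d' + a' * d + b * c' + b' * c + B * (b * d' + b' * d) + g * G + h * F + B * h * G))"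
proof -
  define g h where "g = c * c' + A * d * d'" and "h = c * d' + c' * d + B * d * d'"
  \<comment> \<open>The difference is an explicit combination of the two defining relations, which
    leaves a polynomial identity. Modulo the first relation, \<open>g + h * r\<close> is the
    coefficient of \<open>u * u\<close> in the product.\<close>
  have "L a b c d * L a' b' c' d' =
     L (a * a' + A * b * b' + g * C + A * h * D)
       (a * b' + a' * b + B * b * b' + g * D + h * C + B * h * D)
       (a * c' + a' * c + A * (b * d' + b' * d) + g * F + A * h * G)
       (a * d' + a' * d + b * c' + b' * c + B * (b * d' + b' * d) + g * G + h * F + B * h * G)
     + (r * r - (A + B * r)) * (b * b' + (b * d' + b' * d) * u + d * d' * (C + D * r + (F + G * r) * u) + h * D + h * G * u)
     + (u * u - (C + D * r + (F + G * r) * u)) * (c + d * r) * (c' + d' * r)"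
    unfolding L_def lin4_def g_def h_def by Groebner_Basis.algebra
  then show ?thesis
    by (simp add: r u g_def h_def Let_def)
qed

text \<open>The even constant terms \<open>2 * A\<close> and \<open>2 * C\<close> make the constant
  coefficients of all basis products even. For independence, \<open>r\<close> is real and
  \<open>u\<close> is not, so the imaginary part of a relation kills the coefficient of
  \<open>u\<close>; irrationality of \<open>r\<close> does the rest.\<close>

lemma even_quartic_basis_tower:
  fixes r u :: complex and A B C D F G :: int
  assumes r: "r \<in> \<real>" "r \<notin> \<rat>" and u: "Im u \<noteq> 0"
    and rr: "r * r = of_int (2 * A) + of_int B * r"
    and uu: "u * u = of_int (2 * C) + of_int D * r + (of_int F + of_int G * r) * u"
  shows "even_quartic_basis r u (r * u)"
proof
  let ?L = "lin4 r u (r * u)" and ?I = "even_span r u (r * u)"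
  have II: "?L (of_int (2 * a)) (of_int b) (of_int c) (of_int d) \<in> ?I" for a b c d
    unfolding even_span_def by blast
  note m = lin4_mult_tower[OF rr uu, unfolded Let_def]
  have e: "r = ?L 0 1 0 0" "u = ?L 0 0 1 0" "r * u = ?L 0 0 0 1"
    by (simp_all add: lin4_def)
  show "r * r \<in> ?I"
    using II[of A B 0 0] by (simp add: rr lin4_def)
  show "r * u \<in> ?I"
    using II[of 0 0 0 1] by (simp add: lin4_def)
  show "u * u \<in> ?I"
    using II[of C D F G] by (simp add: uu lin4_def algebra_simps)
  have "r * (r * u) = (of_int (2 * A) + of_int B * r) * u"
    by (simp only: rr flip: mult.assoc)
  also have "\<dots> = ?L (of_int (2 * 0)) (of_int 0) (of_int (2 * A)) (of_int B)"
    by (simp add: lin4_def algebra_simps)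
  finally show "r * (r * u) \<in> ?I"
    using II by metis
  have "u * (r * u) = ?L (of_int (2 * (A * D))) (of_int (2 * C + B * D)) (of_int (2 * A * G)) (of_int (F + B * G))"
    using m[of 0 0 1 0 0 0 0 1] by (simp add: e(2)[symmetric] e(3)[symmetric] mult.assoc)
  then show "u * (r * u) \<in> ?I"
    using II by metis
  have "r * u * (r * u) = ?L (of_int (2 * (2 * A * C + A * B * D))) (of_int (2 * A * D + B * 2 * C + B * B * D))
      (of_int (2 * A * F + 2 * A * B * G)) (of_int (2 * A * G + B * F + B * B * G))"
    using m[of 0 0 0 1 0 0 0 1] by (simp add: e(3)[symmetric] algebra_simps)
  then show "r * u * (r * u) \<in> ?I"
    using II by metis
next
  fix a b c d :: rat
  assume eq: "of_rat a + of_rat b * r + of_rat c * u + of_rat d * (r * u) = 0"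
  have lin: "x = 0 \<and> y = 0" if "of_rat x + of_rat y * r = 0" for x y :: rat
  proof -
    have "y = 0"
    proof (rule ccontr)
      assume "y \<noteq> 0"
      then have "r = of_rat (- x / y)"
        using that by (simp add: field_simps of_rat_divide of_rat_minus eq_neg_iff_add_eq_0)
      then show False
        using r(2) by simp
    qed
    then show ?thesis
      using that by simp
  qed
  define s where "s = Re r"
  have rs: "r = of_real s"
    using r(1) by (simp add: s_def complex_is_Real_iff complex_eq_iff)
  have q: "(of_rat q :: complex) = of_real (of_rat q)" for q
    by (cases q) (simp add: of_rat_rat)
  have "Im ((of_rat c + of_rat d * r) * u) = 0"
    using arg_cong[OF eq, of Im] unfolding rs q by (simp add: algebra_simps)
  moreover have cd: "of_rat c + of_rat d * r = of_real (of_rat c + of_rat d * s)"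
    by (simp add: rs q)
  ultimately have "of_rat c + of_rat d * s = 0"
    using u by (simp add: cd)
  then have "of_rat c + of_rat d * r = 0"
    by (simp add: cd)
  then have "c = 0" "d = 0"
    using lin by auto
  then show "a = 0 \<and> b = 0 \<and> c = 0 \<and> d = 0"
    using eq lin by simp
qed

text \<open>A rational algebraic integer is an integer, and none lies strictly between
  \<open>k\<close> and \<open>Suc k\<close>.\<close>

lemma complex_of_real_sqrt_notin_Rats:
  fixes k n :: nat
  assumes "k\<^sup>2 < n" "n < (Suc k)\<^sup>2"
  shows "complex_of_real (sqrt (real n)) \<notin> \<rat>"
proof
  assume "complex_of_real (sqrt (real n)) \<in> \<rat>"
  then obtain q where "complex_of_real (sqrt (real n)) = of_rat q"
    by (rule Rats_cases)
  also have "\<dots> = of_real (of_rat q)"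
    by (cases q) (simp add: of_rat_rat)
  finally have "sqrt (real n) \<in> \<rat>"
    by simp
  moreover have "algebraic_int (sqrt (real n))"
    by (intro algebraic_int_sqrt algebraic_int_of_nat)
  ultimately have "sqrt (real n) \<in> \<int>"
    using rational_algebraic_int_is_int by blast
  then obtain m where m: "sqrt (real n) = of_int m"
    by (rule Ints_cases)
  then have "m \<ge> 0"
    by (metis of_int_0_le_iff real_sqrt_ge_0_iff of_nat_0_le_iff)
  then obtain j where j: "m = int j"
    using zero_le_imp_eq_int by blast
  then have "real n = (real j)\<^sup>2"
    using m by (metis of_int_of_nat_eq of_nat_0_le_iff real_sqrt_pow2)
  then have "n = j\<^sup>2"
    by (metis of_nat_eq_iff of_nat_power)
  then have "k < j" "j < Suc k"
    using assms power_less_imp_less_base by auto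
  then show False
    by simp
qed

lemma imaginary_sqrt_squared:
  "s \<ge> 0 \<Longrightarrow> (\<i> * of_real (sqrt s)) * (\<i> * of_real (sqrt s)) = - complex_of_real s"
  by (simp add: complex_eq_iff)

section \<open>Fields generated by a root of a quartic\<close>

lemma lin4_mult_power:
  fixes x :: complex
  assumes x4: "x * (x * (x * x)) = s0 + s1 * x + s2 * (x * x) + s3 * (x * (x * x))"
  defines "L \<equiv> lin4 x (x * x) (x * (x * x))"
  shows "L a b c d * L a' b' c' d' =
    (let p6 = d * d'; p5 = c * d' + d * c' + s3 * p6; p4 = b * d' + c * c' + d * b' + s2 * p6 + s3 * p5 in
     L (a * a' + s0 * p4)
       (a * b' + b * a' + s0 * p5 + s1 * p4)
       (a * c' + b * b' + c * a' + s0 * p6 + s1 * p5 + s2 * p4)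
       (a * d' + b * c' + c * b' + d * a' + s1 * p6 + s2 * p5 + s3 * p4))"
proof -
  \<comment> \<open>These are the coefficients of \<open>x ^ 6\<close>, \<open>x ^ 5\<close>,
    \<open>x ^ 4\<close> when the product is reduced from the top degree downwards.\<close>
  define p6 p5 p4 where "p6 = d * d'" and "p5 = c * d' + d * c' + s3 * p6"
    and "p4 = b * d' + c * c' + d * b' + s2 * p6 + s3 * p5"
  have "L a b c d * L a' b' c' d' =
     L (a * a' + s0 * p4)
       (a * b' + b * a' + s0 * p5 + s1 * p4)
       (a * c' + b * b' + c * a' + s0 * p6 + s1 * p5 + s2 * p4)
       (a * d' + b * c' + c * b' + d * a' + s1 * p6 + s2 * p5 + s3 * p4)
     + (x * (x * (x * x)) - (s0 + s1 * x + s2 * (x * x) + s3 * (x * (x * x)))) * (p4 + p5 * x + p6 * (x * x))"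
    unfolding L_def lin4_def p4_def p5_def p6_def by Groebner_Basis.algebra
  then show ?thesis
    by (simp add: x4 Let_def flip: p6_def) (simp flip: p5_def p4_def)
qed

definition det3 :: "'a::comm_ring_1 \<Rightarrow> 'a \<Rightarrow> 'a \<Rightarrow> 'a \<Rightarrow> 'a \<Rightarrow> 'a \<Rightarrow> 'a \<Rightarrow> 'a \<Rightarrow> 'a \<Rightarrow> 'a"
  where "det3 a b c d e f g h i = a * (e * i - f * h) - b * (d * i - f * g) + c * (d * h - e * g)"

text \<open>The norm of \<open>a + b x + c x\<^sup>2 + d x\<^sup>3\<close> for \<open>x ^ 4 = 4 + 5 x - 5 x\<^sup>2 - 5 x ^ 3\<close>: the determinant of the
  matrix whose rows are the coefficients of the products with \<open>1, x, x\<^sup>2, x ^ 3\<close>.\<close>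

definition quartic_norm :: "int \<Rightarrow> int \<Rightarrow> int \<Rightarrow> int \<Rightarrow> int"
  where "quartic_norm a b c d =
    (let a1 = 4 * d; b1 = a + 5 * d; c1 = b - 5 * d; d1 = c - 5 * d;
         a2 = 4 * d1; b2 = a1 + 5 * d1; c2 = b1 - 5 * d1; d2 = c1 - 5 * d1;
         a3 = 4 * d2; b3 = a2 + 5 * d2; c3 = b2 - 5 * d2; d3 = c2 - 5 * d2
     in a * det3 b1 c1 d1 b2 c2 d2 b3 c3 d3 - a1 * det3 b c d b2 c2 d2 b3 c3 d3
        + a2 * det3 b c d b1 c1 d1 b3 c3 d3 - a3 * det3 b c d b1 c1 d1 b2 c2 d2)"

text \<open>The vector \<open>(1, x, y, z)\<close> lies in the kernel of the matrix. Weighting the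
  rows with the cofactors of the first column leaves the determinant times the entry 1.\<close>

lemma homogeneous_system_det_0:
  fixes x y z :: "'a::field_char_0"
  assumes "a + b * x + c * y + d * z = 0" "a1 + b1 * x + c1 * y + d1 * z = 0"
    "a2 + b2 * x + c2 * y + d2 * z = 0" "a3 + b3 * x + c3 * y + d3 * z = 0"
  shows "a * det3 b1 c1 d1 b2 c2 d2 b3 c3 d3 - a1 * det3 b c d b2 c2 d2 b3 c3 d3
    + a2 * det3 b c d b1 c1 d1 b3 c3 d3 - a3 * det3 b c d b1 c1 d1 b2 c2 d2 = 0"
proof -
  have "a * det3 b1 c1 d1 b2 c2 d2 b3 c3 d3 - a1 * det3 b c d b2 c2 d2 b3 c3 d3
      + a2 * det3 b c d b1 c1 d1 b3 c3 d3 - a3 * det3 b c d b1 c1 d1 b2 c2 d2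
    = (a + b * x + c * y + d * z) * det3 b1 c1 d1 b2 c2 d2 b3 c3 d3
      - (a1 + b1 * x + c1 * y + d1 * z) * det3 b c d b2 c2 d2 b3 c3 d3
      + (a2 + b2 * x + c2 * y + d2 * z) * det3 b c d b1 c1 d1 b3 c3 d3
      - (a3 + b3 * x + c3 * y + d3 * z) * det3 b c d b1 c1 d1 b2 c2 d2"
    unfolding det3_def by Groebner_Basis.algebra
  then show ?thesis
    by (simp add: assms)
qed

lemma quartic_norm_eq_0:
  fixes x :: complex
  assumes x4: "x * (x * (x * x)) = 4 + 5 * x - 5 * (x * x) - 5 * (x * (x * x))"
    and rel: "of_int a + of_int b * x + of_int c * (x * x) + of_int d * (x * (x * x)) = 0"
  shows "quartic_norm a b c d = 0"
proof -
  \<comment> \<open>Multiplying a relation by \<open>x\<close> and reducing \<open>x ^ 4\<close>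
    gives another relation; three such steps complete the square system.\<close>
  have step: "of_int (4 * d) + of_int (a + 5 * d) * x + of_int (b - 5 * d) * (x * x) + of_int (c - 5 * d) * (x * (x * x)) = 0"
    if "of_int a + of_int b * x + of_int c * (x * x) + of_int d * (x * (x * x)) = 0" for a b c d
  proof -
    have "of_int (4 * d) + of_int (a + 5 * d) * x + of_int (b - 5 * d) * (x * x) + of_int (c - 5 * d) * (x * (x * x))
      = x * (of_int a + of_int b * x + of_int c * (x * x) + of_int d * (x * (x * x)))
        - of_int d * (x * (x * (x * x)) - (4 + 5 * x - 5 * (x * x) - 5 * (x * (x * x))))"
      by (simp add: algebra_simps)
    then show ?thesis
      by (simp add: that x4)
  qed
  have "(of_int (quartic_norm a b c d) :: complex) = 0"
    using homogeneous_system_det_0[OF rel step[OF rel] step[OF step[OF rel]] step[OF step[OF step[OF rel]]]]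
    unfolding quartic_norm_def Let_def det3_def
    by (simp only: of_int_add of_int_diff of_int_mult of_int_numeral)
  then show ?thesis
    by simp
qed

text \<open>The quartic is irreducible modulo 3, so the norm from the field with 81 elements
  vanishes only at 0. The 81 residue vectors are checked one by one.\<close>

lemma quartic_norm_anisotropic_mod_3:
  assumes "quartic_norm a b c d = 0"
  shows "3 dvd a \<and> 3 dvd b \<and> 3 dvd c \<and> 3 dvd d"
proof -
  have "quartic_norm (a mod 3) (b mod 3) (c mod 3) (d mod 3) mod 3 = quartic_norm a b c d mod 3"
    unfolding quartic_norm_def Let_def det3_def
    by (intro mod_add_cong mod_diff_cong mod_mult_cong) simp_all
  then have *: "quartic_norm (a mod 3) (b mod 3) (c mod 3) (d mod 3) mod 3 = 0"
    using assms by simp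
  have "a mod 3 = 0 \<or> a mod 3 = 1 \<or> a mod 3 = 2" "b mod 3 = 0 \<or> b mod 3 = 1 \<or> b mod 3 = 2"
    "c mod 3 = 0 \<or> c mod 3 = 1 \<or> c mod 3 = 2" "d mod 3 = 0 \<or> d mod 3 = 1 \<or> d mod 3 = 2"
    by presburger+
  then have "a mod 3 = 0 \<and> b mod 3 = 0 \<and> c mod 3 = 0 \<and> d mod 3 = 0"
    using * by (elim disjE) (simp_all add: quartic_norm_def det3_def)
  then show ?thesis
    by (simp add: mod_eq_0_iff_dvd)
qed

text \<open>Infinite descent: 3 divides all coefficients of a relation, and dividing by 3 gives a
  relation again.\<close>

lemma quartic_int_independent:
  fixes x :: complex
  assumes x4: "x * (x * (x * x)) = 4 + 5 * x - 5 * (x * x) - 5 * (x * (x * x))"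
    and rel: "of_int a + of_int b * x + of_int c * (x * x) + of_int d * (x * (x * x)) = 0"
  shows "a = 0 \<and> b = 0 \<and> c = 0 \<and> d = 0"
proof -
  have dvd: "3 ^ n dvd a \<and> 3 ^ n dvd b \<and> 3 ^ n dvd c \<and> 3 ^ n dvd d" for n
    using rel
  proof (induction n arbitrary: a b c d)
    case (Suc n)
    obtain a' b' c' d' where *: "a = 3 * a'" "b = 3 * b'" "c = 3 * c'" "d = 3 * d'"
      using quartic_norm_anisotropic_mod_3[OF quartic_norm_eq_0[OF x4 Suc.prems]] by (auto elim!: dvdE)
    have "3 * (of_int a' + of_int b' * x + of_int c' * (x * x) + of_int d' * (x * (x * x))) = 0"
      using Suc.prems by (simp add: * algebra_simps)
    then have "of_int a' + of_int b' * x + of_int c' * (x * x) + of_int d' * (x * (x * x)) = 0"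
      unfolding mult_eq_0_iff by (elim disjE) simp_all
    from Suc.IH[OF this] show ?case
      by (simp add: *)
  qed simp
  have "k = 0" if "\<And>n. 3 ^ n dvd k" for k :: int
  proof (rule ccontr)
    assume "k \<noteq> 0"
    then have "3 ^ nat \<bar>k\<bar> \<le> \<bar>k\<bar>"
      using zdvd_imp_le[of "3 ^ nat \<bar>k\<bar>" "\<bar>k\<bar>"] that by simp
    moreover have "int (nat \<bar>k\<bar>) < 2 ^ nat \<bar>k\<bar>"
      by (rule of_nat_less_two_power)
    moreover have "(2 :: int) ^ nat \<bar>k\<bar> \<le> 3 ^ nat \<bar>k\<bar>"
      by (rule power_mono) auto
    ultimately show False
      by simp
  qed
  then show ?thesis
    using dvd by blast
qed

lemma quartic_rat_independent:
  fixes x :: complex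
  assumes x4: "x * (x * (x * x)) = 4 + 5 * x - 5 * (x * x) - 5 * (x * (x * x))"
    and rel: "of_rat a + of_rat b * x + of_rat c * (x * x) + of_rat d * (x * (x * x)) = 0"
  shows "a = 0 \<and> b = 0 \<and> c = 0 \<and> d = 0"
proof -
  obtain m1 m2 m3 m4 n1 n2 n3 n4 :: int where
    n: "n1 > 0" "n2 > 0" "n3 > 0" "n4 > 0"
    and abcd: "a = of_int m1 / of_int n1" "b = of_int m2 / of_int n2" "c = of_int m3 / of_int n3" "d = of_int m4 / of_int n4"
    by (metis Fract_of_int_quotient Rat_cases)
  have "of_int (m1 * n2 * n3 * n4) + of_int (m2 * n1 * n3 * n4) * x
      + of_int (m3 * n1 * n2 * n4) * (x * x) + of_int (m4 * n1 * n2 * n3) * (x * (x * x))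
    = of_int (n1 * n2 * n3 * n4) * (of_rat a + of_rat b * x + of_rat c * (x * x) + of_rat d * (x * (x * x)))"
    using n unfolding abcd by (simp add: of_rat_divide field_simps)
  then have "of_int (m1 * n2 * n3 * n4) + of_int (m2 * n1 * n3 * n4) * x
      + of_int (m3 * n1 * n2 * n4) * (x * x) + of_int (m4 * n1 * n2 * n3) * (x * (x * x)) = 0"
    by (simp add: rel)
  from quartic_int_independent[OF x4 this] show ?thesis
    using n unfolding abcd by simp
qed

lemma even_quartic_basis_root:
  fixes x :: complex
  assumes x4: "x * (x * (x * x)) = 4 + 5 * x - 5 * (x * x) - 5 * (x * (x * x))"
  shows "even_quartic_basis x (x * x) (x * (x * x))"
proof
  let ?I = "even_span x (x * x) (x * (x * x))"
  have mem: "t \<in> ?I"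
    if "t = of_int (2 * a) + of_int b * x + of_int c * (x * x) + of_int d * (x * (x * x))" for t a b c d
    using that unfolding even_span_def lin4_def by blast
  show "x * x \<in> ?I" "x * (x * x) \<in> ?I" "x * (x * (x * x)) \<in> ?I"
    by (rule mem[of _ 0 0 1 0], simp) (rule mem[of _ 0 0 0 1], simp, rule mem[of _ 2 5 "-5" "-5"], simp add: x4)
  show "x * x * (x * x) \<in> ?I"
    by (rule mem[of _ 2 5 "-5" "-5"]) (use x4 in \<open>simp add: mult.assoc\<close>)
  have "x * x * (x * (x * x)) = - 20 - 21 * x + 30 * (x * x) + 20 * (x * (x * x))"
    using x4 by Groebner_Basis.algebra
  then show "x * x * (x * (x * x)) \<in> ?I"
    by (intro mem[of _ "-10" "-21" 30 20]) simp
  have "x * (x * x) * (x * (x * x)) = 80 + 80 * x - 121 * (x * x) - 70 * (x * (x * x))"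
    using x4 by Groebner_Basis.algebra
  then show "x * (x * x) * (x * (x * x)) \<in> ?I"
    by (intro mem[of _ 40 80 "-121" "-70"]) simp
qed (rule quartic_rat_independent[OF x4])

section \<open>The five curves\<close>

text \<open>The witnesses \<open>z\<close> and \<open>l\<close> keep division out: each premise is a
  polynomial equation that the multiplication table decides, and \<open>z\<close> certifies that the
  tangent is not vertical.\<close>

lemma point_add_doubleI:
  fixes x :: "'a::field_char_0"
  assumes "(2 * y + a1 * x + a3) * z = 1"
    and "l * (2 * y + a1 * x + a3) = 3 * x\<^sup>2 + 2 * a2 * x + a4 - a1 * y"
    and "x' = l\<^sup>2 + a1 * l - a2 - 2 * x" and "y' = - (y + l * (x' - x)) - a1 * x' - a3"
  shows "point_add (Weierstrass a1 a2 a3 a4 a6) (Affine_point x y) (Affine_point x y) = Affine_point x' y'"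
  using assms by (intro point_add_double) auto

lemma point_add_chordI:
  fixes x1 :: "'a::field_char_0"
  assumes "(x2 - x1) * z = 1" and "l * (x2 - x1) = y2 - y1"
    and "x' = l\<^sup>2 + a1 * l - a2 - x1 - x2" and "y' = - (y1 + l * (x' - x1)) - a1 * x' - a3"
  shows "point_add (Weierstrass a1 a2 a3 a4 a6) (Affine_point x1 y1) (Affine_point x2 y2) = Affine_point x' y'"
  using assms by (intro point_add_chord) auto

text \<open>The curve is a rescaled Tate normal form. Its field and parameters are those of the fibre over
  \<open>X = 1\<close> of the model
  \<open>Y ^ 4 + (X ^ 3 + X\<^sup>2 - X + 2) Y ^ 3 + (X ^ 3 - 3 X + 1) Y\<^sup>2 - (X ^ 4 + 2 X) Y + X ^ 3 + X\<^sup>2 = 0\<close> of the modular curve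
  \<open>X\<^sub>1(17)\<close>. In this field 2 is \<open>\<pp>\<^sup>3 \<qq>\<close>, and parity of the constant coefficient is reduction modulo \<open>\<qq>\<close>.\<close>

lemma exists_Z17_Z:
  "\<exists>K E. number_field_of_degree 4 K \<and> elliptic_curve_over K E \<and>
    contains_subgroup_iso (mordell_weil_group K E)
      (integer_mod_group 17 \<times>\<times> integer_group)"
proof -
  \<comment> \<open>The polynomial changes sign from -4 at 0 to 2 at 1.\<close>
  have "\<exists>t\<ge>0. t \<le> 1 \<and> t ^ 4 + 5 * t ^ 3 + 5 * t\<^sup>2 - 5 * t - 4 = (0 :: real)"
    by (rule IVT') (auto intro!: continuous_intros)
  then obtain t :: real where t: "t ^ 4 + 5 * t ^ 3 + 5 * t\<^sup>2 - 5 * t - 4 = 0"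
    by blast
  define x where "x = complex_of_real t"
  have "x ^ 4 + 5 * x ^ 3 + 5 * x\<^sup>2 - 5 * x - 4 = of_real (t ^ 4 + 5 * t ^ 3 + 5 * t\<^sup>2 - 5 * t - 4)"
    by (simp add: x_def)
  then have "x ^ 4 + 5 * x ^ 3 + 5 * x\<^sup>2 - 5 * x - 4 = 0"
    by (simp add: t)
  then have x4: "x * (x * (x * x)) = 4 + 5 * x - 5 * (x * x) - 5 * (x * (x * x))"
    by Groebner_Basis.algebra
  then have x4': "x * (x * (x * x)) = 4 + 5 * x + (- 5) * (x * x) + (- 5) * (x * (x * x))"
    by simp
  interpret even_quartic_basis x "x * x" "x * (x * x)"
    using x4 by (rule even_quartic_basis_root)
  let ?K = "rat_span x (x * x) (x * (x * x))" and ?L = "lin4 x (x * x) (x * (x * x))"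
  note L = lin4_mult_power[OF x4'] Let_def lin4_simps power2_eq_square power3_eq_cube
  let ?E = "Weierstrass (?L 21 (- 7) (- 11) (- 2)) (?L (- 152) 58 106 24) (?L 32 (- 16) (- 26) (- 6)) 0 0"
  have 0: "0 \<in> ?K" "0 \<in> int_span x (x * x) (x * (x * x))"
    using subfield_closed(1)[OF subfield] R_diff[OF R1 R1] by auto
  \<comment> \<open>The second factor is the inverse of the discriminant and certifies that it is
    nonzero.\<close>
  have "discriminant ?E * (?L (- (5445385 / 13238272)) (- (12150719 / 13238272)) (4892353 / 13238272) (16636961 / 13238272)) = 1"
    by (simp add: L)
  then have EK: "elliptic_curve_over ?K ?E"
    using 0 by (auto simp: elliptic_curve_over_def intro!: lin4_rat_span)
  let ?G = "mordell_weil_group ?K ?E"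
  interpret G: comm_group ?G
    using subfield EK by (rule comm_group_mordell_weil)
  note pow_double = mordell_weil_pow_double[OF subfield EK] and pow_Suc = mordell_weil_pow_Suc[where K = ?K and E = ?E]
  let ?Q = "Affine_point (?L (405 / 1024) (- (109 / 1024)) (787 / 1024) (307 / 1024)) (?L (- (63655 / 32768)) (- (11793 / 32768)) (17263 / 32768) (4111 / 32768))"
  have "on_curve ?E ?Q"
    by (simp add: L)
  then have Q: "?Q \<in> carrier ?G"
    by (simp add: lin4_rat_span del: on_curve.simps)
  have inf: "k = 0" if "?Q [^]\<^bsub>?G\<^esub> k = \<one>\<^bsub>?G\<^esub>" for k :: int
  proof (rule infinite_order[OF subfield EK _ Q _ _ _ that])
    show "set_weierstrass ?E \<subseteq> int_span x (x * x) (x * (x * x))"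
      using 0 by (auto intro!: lin4_int_span)
    \<comment> \<open>Here \<open>1024 = 4 * 256\<close> with 256 even, while the constant
      coefficient 405 of the numerator is odd.\<close>
    show "?L (405 / 1024) (- (109 / 1024)) (787 / 1024) (307 / 1024) * (4 * ?L 256 0 0 0) = ?L 405 (- 109) 787 307"
      by (simp add: L)
    show "?L 256 0 0 0 \<in> even_span x (x * x) (x * (x * x))"
      by (rule lin4_even_span) simp_all
    show "cong1 (?L 405 (- 109) 787 307)"
      by (rule cong1_lin4) simp_all
  qed
  let ?T = "Affine_point 0 0 :: complex point"
  have T: "?T \<in> carrier ?G"
    using 0 by simp
  have T_2: "?T [^]\<^bsub>?G\<^esub> (2 :: nat) = Affine_point (?L 152 (- 58) (- 106) (- 24)) (?L (- 3344) 1204 2296 524)"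
  proof -
    have "point_add ?E (Affine_point 0 0) (Affine_point 0 0) = Affine_point (?L 152 (- 58) (- 106) (- 24)) (?L (- 3344) 1204 2296 524)"
      by (rule point_add_doubleI[where z = "?L (- (19 / 64)) (- (21 / 64)) (27 / 64) (11 / 64)" and l = "0"]) (simp_all add: L)
    then show ?thesis
      using mordell_weil_pow_2[where P = ?T and K = ?K and E = ?E] by (simp del: point_add.simps)
  qed
  have T_4: "?T [^]\<^bsub>?G\<^esub> (4 :: nat) = Affine_point (?L 48 (- 16) (- 31) (- 7)) (?L (- 744) 258 503 115)"
  proof -
    have "point_add ?E (Affine_point (?L 152 (- 58) (- 106) (- 24)) (?L (- 3344) 1204 2296 524)) (Affine_point (?L 152 (- 58) (- 106) (- 24)) (?L (- 3344) 1204 2296 524)) = Affine_point (?L 48 (- 16) (- 31) (- 7)) (?L (- 744) 258 503 115)"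
      by (rule point_add_doubleI[where z = "?L (- (59 / 32)) (- (49 / 32)) (95 / 32) (35 / 32)" and l = "?L (- 29) 9 18 4"]) (simp_all add: L)
    then show ?thesis
      using pow_double[OF T, of 2] by (simp add: T_2 del: point_add.simps)
  qed
  have T_8: "?T [^]\<^bsub>?G\<^esub> (8 :: nat) = Affine_point (?L 20 (- 9) (- 14) (- 3)) (?L (- 276) 97 188 43)"
  proof -
    have "point_add ?E (Affine_point (?L 48 (- 16) (- 31) (- 7)) (?L (- 744) 258 503 115)) (Affine_point (?L 48 (- 16) (- 31) (- 7)) (?L (- 744) 258 503 115)) = Affine_point (?L 20 (- 9) (- 14) (- 3)) (?L (- 276) 97 188 43)"
      by (rule point_add_doubleI[where z = "?L (- (285 / 128)) (- (267 / 128)) (437 / 128) (213 / 128)" and l = "?L (- 20) 5 10 2"]) (simp_all add: L)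
    then show ?thesis
      using pow_double[OF T, of 4] by (simp add: T_4 del: point_add.simps)
  qed
  \<comment> \<open>This is \<open>- T\<close>, with abscissa 0 and ordinate
    \<open>- a3\<close>.\<close>
  have T_16: "?T [^]\<^bsub>?G\<^esub> (16 :: nat) = Affine_point 0 (?L (- 32) 16 26 6)"
  proof -
    have "point_add ?E (Affine_point (?L 20 (- 9) (- 14) (- 3)) (?L (- 276) 97 188 43)) (Affine_point (?L 20 (- 9) (- 14) (- 3)) (?L (- 276) 97 188 43)) = Affine_point 0 (?L (- 32) 16 26 6)"
      by (rule point_add_doubleI[where z = "?L (5 / 8) (3 / 8) (- (9 / 8)) (- (1 / 8))" and l = "?L (- 13) 5 9 2"]) (simp_all add: L)
    then show ?thesis
      using pow_double[OF T, of 8] by (simp add: T_8 del: point_add.simps)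
  qed
  have T_17: "?T [^]\<^bsub>?G\<^esub> (17 :: nat) = Point_at_infinity"
    using pow_Suc[where P = ?T and n = 16] by (simp add: T_16 add: L)
  have "contains_subgroup_iso ?G (integer_mod_group 17 \<times>\<times> integer_group)"
  proof (rule G.contains_subgroup_iso_Zmod_Z[OF T Q])
    show "?T [^]\<^bsub>?G\<^esub> int 17 = \<one>\<^bsub>?G\<^esub>"
      by (simp only: int_pow_int T_17 mordell_weil_simps)
    show "int 17 dvd b" if "?T [^]\<^bsub>?G\<^esub> b = \<one>\<^bsub>?G\<^esub>" for b :: int
      using G.int_pow_eq_one_imp_prime_dvd[OF T _ _ _ that, of 17] by (simp add: T_17)
  qed (fact inf | simp)+
  then show ?thesis
    using number_field EK by blast
qed

text \<open>Over \<open>k = \<rat>(\<surd>2)\<close> the curve has a point of order 7 (Tate normal form \<open>c = d\<^sup>2 - d\<close>, \<open>b = d ^ 3 - d\<^sup>2\<close> with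
  \<open>d\<^sup>2 - d + 1/8 = 0\<close>) and a 3-isogeny, whose kernel becomes rational over \<open>k(\<surd>(3 - 6 \<surd>2))\<close>. The point \<open>Q\<close> is
  \<open>4 P + 2 T\<close> with \<open>x(P) = - 16\<close> and \<open>T\<close> of order 21; the torsion summand moves it close to infinity at
  one of the primes above 2.\<close>

lemma exists_Z21_Z:
  "\<exists>K E. number_field_of_degree 4 K \<and> elliptic_curve_over K E \<and>
    contains_subgroup_iso (mordell_weil_group K E)
      (integer_mod_group 21 \<times>\<times> integer_group)"
proof -
  \<comment> \<open>With this \<open>u\<close>, a root of
    \<open>u\<^sup>2 = (1 + r) u - 2 r\<close>, the equation modulo \<open>r\<close> reads
    \<open>u\<^sup>2 = u\<close>. Two primes therefore lie above \<open>r\<close>, and the even span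
    is the one that contains \<open>u\<close>.\<close>
  define r u :: complex where "r = of_real (sqrt 2)"
    and "u = (1 + r + \<i> * of_real (sqrt (6 * sqrt 2 - 3))) / 2"
  have r2: "r * r = 2"
    by (simp add: r_def flip: of_real_mult)
  have pos: "6 * sqrt 2 - 3 > (0 :: real)"
    using real_sqrt_ge_one[of 2] by linarith
  have w2: "(2 * u - 1 - r) * (2 * u - 1 - r) = 3 - 6 * r"
  proof -
    have "2 * u - 1 - r = \<i> * of_real (sqrt (6 * sqrt 2 - 3))"
      by (simp add: u_def field_simps)
    then show ?thesis
      using imaginary_sqrt_squared[of "6 * sqrt 2 - 3"] pos by (simp add: r_def)
  qed
  have uu: "u * u = of_int (2 * 0) + of_int (- 2) * r + (of_int 1 + of_int 1 * r) * u"
    using w2 r2 by simp Groebner_Basis.algebra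
  have rr: "r * r = of_int (2 * 1) + of_int 0 * r"
    by (simp add: r2)
  interpret even_quartic_basis r u "r * u"
  proof (rule even_quartic_basis_tower[OF _ _ _ rr uu])
    show "r \<notin> \<rat>"
      using complex_of_real_sqrt_notin_Rats[of 1 2] by (simp add: r_def power2_eq_square)
    show "Im u \<noteq> 0"
      using pos by (simp add: u_def r_def)
  qed (simp add: r_def)
  let ?K = "rat_span r u (r * u)" and ?L = "lin4 r u (r * u)"
  note L = lin4_mult_tower[OF rr uu] Let_def lin4_simps power2_eq_square power3_eq_cube
  let ?E = "Weierstrass (?L (- 9) 0 0 0) (?L 4 2 0 0) (?L (- 32) (- 16) 0 0) 0 0"
  have 0: "0 \<in> ?K" "0 \<in> int_span r u (r * u)"
    using subfield_closed(1)[OF subfield] R_diff[OF R1 R1] by auto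
  have "discriminant ?E * (?L (- (13 / 50176)) (- (17 / 100352)) 0 0) = 1"
    by (simp add: L)
  then have EK: "elliptic_curve_over ?K ?E"
    using 0 by (auto simp: elliptic_curve_over_def intro!: lin4_rat_span)
  let ?G = "mordell_weil_group ?K ?E"
  interpret G: comm_group ?G
    using subfield EK by (rule comm_group_mordell_weil)
  note pow_double = mordell_weil_pow_double[OF subfield EK] and pow_Suc = mordell_weil_pow_Suc[where K = ?K and E = ?E]
  let ?Q = "Affine_point (?L (- (51614647 / 7589408)) (161315 / 3794704) (- (36572895 / 7589408)) (18879875 / 7589408)) (?L (- (26428521413 / 924010424)) (479260596767 / 29568333568) (- (196098127325 / 14784166784)) (197559801635 / 29568333568))"
  have "on_curve ?E ?Q"
    by (simp add: L)
  then have Q: "?Q \<in> carrier ?G"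
    by (simp add: lin4_rat_span del: on_curve.simps)
  have inf: "k = 0" if "?Q [^]\<^bsub>?G\<^esub> k = \<one>\<^bsub>?G\<^esub>" for k :: int
  proof (rule infinite_order[OF subfield EK _ Q _ _ _ that])
    show "set_weierstrass ?E \<subseteq> int_span r u (r * u)"
      using 0 by (auto intro!: lin4_int_span)
    show "?L (- (51614647 / 7589408)) (161315 / 3794704) (- (36572895 / 7589408)) (18879875 / 7589408) * (4 * ?L 1897352 0 0 0) = ?L (- 51614647) 322630 (- 36572895) 18879875"
      by (simp add: L)
    show "?L 1897352 0 0 0 \<in> even_span r u (r * u)"
      by (rule lin4_even_span) simp_all
    show "cong1 (?L (- 51614647) 322630 (- 36572895) 18879875)"
      by (rule cong1_lin4) simp_all
  qed
  let ?S = "Affine_point 0 0 :: complex point"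
  have S: "?S \<in> carrier ?G"
    using 0 by simp
  let ?T = "Affine_point (?L (- (16 / 3)) (- (8 / 3)) 0 0) (?L (- (64 / 9)) (- (32 / 9)) 0 (- (8 / 9)))"
  have "on_curve ?E ?T"
    by (simp add: L)
  then have T: "?T \<in> carrier ?G"
    using 0 by (simp add: lin4_rat_span del: on_curve.simps)
  have S_2: "?S [^]\<^bsub>?G\<^esub> (2 :: nat) = Affine_point (?L (- 4) (- 2) 0 0) (?L (- 4) (- 2) 0 0)"
  proof -
    have "point_add ?E (Affine_point 0 0) (Affine_point 0 0) = Affine_point (?L (- 4) (- 2) 0 0) (?L (- 4) (- 2) 0 0)"
      by (rule point_add_doubleI[where z = "?L (- (1 / 16)) (1 / 32) 0 0" and l = "0"]) (simp_all add: L)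
    then show ?thesis
      using mordell_weil_pow_2[where P = ?S and K = ?K and E = ?E] by (simp del: point_add.simps)
  qed
  have S_3: "?S [^]\<^bsub>?G\<^esub> (3 :: nat) = Affine_point (?L (- 8) 0 0 0) (?L (- 32) 16 0 0)"
  proof -
    have "point_add ?E (Affine_point (?L (- 4) (- 2) 0 0) (?L (- 4) (- 2) 0 0)) (Affine_point 0 0) = Affine_point (?L (- 8) 0 0 0) (?L (- 32) 16 0 0)"
      by (rule point_add_chordI[where z = "?L (1 / 2) (- (1 / 4)) 0 0" and l = "?L 1 0 0 0"]) (simp_all add: L)
    then show ?thesis
      using pow_Suc[where P = ?S and n = 2] by (simp add: S_2 del: point_add.simps)
  qed
  have S_6: "?S [^]\<^bsub>?G\<^esub> (6 :: nat) = Affine_point 0 (?L 32 16 0 0)"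
  proof -
    have "point_add ?E (Affine_point (?L (- 8) 0 0 0) (?L (- 32) 16 0 0)) (Affine_point (?L (- 8) 0 0 0) (?L (- 32) 16 0 0)) = Affine_point 0 (?L 32 16 0 0)"
      by (rule point_add_doubleI[where z = "?L (- (3 / 8)) (- (1 / 4)) 0 0" and l = "?L 4 (- 2) 0 0"]) (simp_all add: L)
    then show ?thesis
      using pow_double[OF S, of 3] by (simp add: S_3 del: point_add.simps)
  qed
  have S_7: "?S [^]\<^bsub>?G\<^esub> (7 :: nat) = Point_at_infinity"
    using pow_Suc[where P = ?S and n = 6] by (simp add: S_6 add: L)
  \<comment> \<open>\<open>2 T\<close> has the same abscissa as \<open>T\<close> but another
    ordinate, so it is \<open>- T\<close> and \<open>T\<close> has order 3.\<close>
  have T_2: "?T [^]\<^bsub>?G\<^esub> (2 :: nat) = Affine_point (?L (- (16 / 3)) (- (8 / 3)) 0 0) (?L (- (80 / 9)) (- (40 / 9)) 0 (8 / 9))"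
  proof -
    have "point_add ?E (Affine_point (?L (- (16 / 3)) (- (8 / 3)) 0 0) (?L (- (64 / 9)) (- (32 / 9)) 0 (- (8 / 9)))) (Affine_point (?L (- (16 / 3)) (- (8 / 3)) 0 0) (?L (- (64 / 9)) (- (32 / 9)) 0 (- (8 / 9)))) = Affine_point (?L (- (16 / 3)) (- (8 / 3)) 0 0) (?L (- (80 / 9)) (- (40 / 9)) 0 (8 / 9))"
      by (rule point_add_doubleI[where z = "?L (- (9 / 56)) (- (15 / 112)) (3 / 14) (3 / 56)" and l = "?L 4 0 (- 1) 1"]) (simp_all add: L)
    then show ?thesis
      using mordell_weil_pow_2[where P = ?T and K = ?K and E = ?E] by (simp del: point_add.simps)
  qed
  have T_3: "?T [^]\<^bsub>?G\<^esub> (3 :: nat) = Point_at_infinity"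
    using pow_Suc[where P = ?T and n = 2] by (simp add: T_2 add: L)
  let ?ST = "?S \<otimes>\<^bsub>?G\<^esub> ?T"
  have "?ST [^]\<^bsub>?G\<^esub> (7 * 3 :: nat) = \<one>\<^bsub>?G\<^esub>"
  proof -
    have "?ST [^]\<^bsub>?G\<^esub> (7 * 3 :: nat) = (?S [^]\<^bsub>?G\<^esub> (7 :: nat)) [^]\<^bsub>?G\<^esub> (3 :: nat)
        \<otimes>\<^bsub>?G\<^esub> (?T [^]\<^bsub>?G\<^esub> (3 :: nat)) [^]\<^bsub>?G\<^esub> (7 :: nat)"
      using S T by (simp only: G.nat_pow_distrib G.nat_pow_pow mult.commute)
    then show ?thesis
      unfolding S_7 T_3 mordell_weil_simps(2)[of ?K ?E, symmetric] G.nat_pow_one by (simp only: G.l_one G.one_closed)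
  qed
  moreover have "(7 * 3 :: nat) = 21"
    by simp
  ultimately have ST_21: "?ST [^]\<^bsub>?G\<^esub> (21 :: nat) = \<one>\<^bsub>?G\<^esub>"
    by (simp only:)
  have "contains_subgroup_iso ?G (integer_mod_group 21 \<times>\<times> integer_group)"
  proof (rule G.contains_subgroup_iso_Zmod_Z[OF G.m_closed[OF S T] Q])
    show "?ST [^]\<^bsub>?G\<^esub> int 21 = \<one>\<^bsub>?G\<^esub>"
      by (simp only: int_pow_int ST_21)
    show "int 21 dvd b" if "?ST [^]\<^bsub>?G\<^esub> b = \<one>\<^bsub>?G\<^esub>" for b :: int
      using G.int_pow_mult_eq_one_imp_dvd[OF S T _ _ _ _ _ _ _ that, of 7 3] by (simp add: S_7 T_3)
  qed (fact inf | simp)+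
  then show ?thesis
    using number_field EK by blast
qed

text \<open>The Tate normal form of a point of order 9, \<open>c = d\<^sup>2 (d - 1)\<close> and \<open>b = c (d\<^sup>2 - d + 1)\<close>, has its full 3-torsion rational
  over a field containing the cube roots of unity iff \<open>d ^ 3 - 6 d\<^sup>2 + 3 d + 1\<close> is a cube. For \<open>d = \<surd>6 / 3\<close> it is
  \<open>(d - 1) ^ 3\<close>.\<close>

lemma exists_Z3_Z9_Z:
  "\<exists>K E. number_field_of_degree 4 K \<and> elliptic_curve_over K E \<and>
    contains_subgroup_iso (mordell_weil_group K E)
      (integer_mod_group 3 \<times>\<times> integer_mod_group 9 \<times>\<times> integer_group)"
proof -
  \<comment> \<open>Adding 1 to the square root of -3, whose square is odd, gives
    \<open>u\<^sup>2 = 2 u - 4\<close> with even constant term.\<close>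
  define r u :: complex where "r = of_real (sqrt 6)" and "u = 1 + \<i> * of_real (sqrt 3)"
  have rr: "r * r = of_int (2 * 3) + of_int 0 * r"
    by (simp add: r_def flip: of_real_mult)
  have uu: "u * u = of_int (2 * (- 2)) + of_int 0 * r + (of_int 2 + of_int 0 * r) * u"
    using imaginary_sqrt_squared[of 3] by (simp add: u_def algebra_simps)
  interpret even_quartic_basis r u "r * u"
  proof (rule even_quartic_basis_tower[OF _ _ _ rr uu])
    show "r \<notin> \<rat>"
      using complex_of_real_sqrt_notin_Rats[of 2 6] by (simp add: r_def power2_eq_square)
  qed (simp_all add: r_def u_def)
  let ?K = "rat_span r u (r * u)" and ?L = "lin4 r u (r * u)"
  note L = lin4_mult_tower[OF rr uu] Let_def lin4_simps power2_eq_square power3_eq_cube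
  let ?E = "Weierstrass (?L 11 3 0 0) (?L 18 4 0 0) (?L 234 90 0 0) 0 0"
  have 0: "0 \<in> ?K" "0 \<in> int_span r u (r * u)"
    using subfield_closed(1)[OF subfield] R_diff[OF R1 R1] by auto
  have "discriminant ?E * (?L (1 / 109744) (215 / 53335584) 0 0) = 1"
    by (simp add: L)
  then have EK: "elliptic_curve_over ?K ?E"
    using 0 by (auto simp: elliptic_curve_over_def intro!: lin4_rat_span)
  let ?G = "mordell_weil_group ?K ?E"
  interpret G: comm_group ?G
    using subfield EK by (rule comm_group_mordell_weil)
  note pow_double = mordell_weil_pow_double[OF subfield EK] and pow_Suc = mordell_weil_pow_Suc[where K = ?K and E = ?E]
  let ?Q = "Affine_point (?L (843 / 32) (- (197 / 8)) 0 0) (?L (6219 / 16) (- (32019 / 256)) 0 0)"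
  have "on_curve ?E ?Q"
    by (simp add: L)
  then have Q: "?Q \<in> carrier ?G"
    by (simp add: lin4_rat_span del: on_curve.simps)
  have inf: "k = 0" if "?Q [^]\<^bsub>?G\<^esub> k = \<one>\<^bsub>?G\<^esub>" for k :: int
  proof (rule infinite_order[OF subfield EK _ Q _ _ _ that])
    show "set_weierstrass ?E \<subseteq> int_span r u (r * u)"
      using 0 by (auto intro!: lin4_int_span)
    show "?L (843 / 32) (- (197 / 8)) 0 0 * (4 * ?L 8 0 0 0) = ?L 843 (- 788) 0 0"
      by (simp add: L)
    show "?L 8 0 0 0 \<in> even_span r u (r * u)"
      by (rule lin4_even_span) simp_all
    show "cong1 (?L 843 (- 788) 0 0)"
      by (rule cong1_lin4) simp_all
  qed
  let ?T = "Affine_point 0 0 :: complex point"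
  have T: "?T \<in> carrier ?G"
    using 0 by simp
  let ?S = "Affine_point (?L (- 27) (- 6) 0 0) (?L 78 30 (15 / 2) (- (3 / 2)))"
  have "on_curve ?E ?S"
    by (simp add: L)
  then have S: "?S \<in> carrier ?G"
    using 0 by (simp add: lin4_rat_span del: on_curve.simps)
  have T_2: "?T [^]\<^bsub>?G\<^esub> (2 :: nat) = Affine_point (?L (- 18) (- 4) 0 0) (?L 36 8 0 0)"
  proof -
    have "point_add ?E (Affine_point 0 0) (Affine_point 0 0) = Affine_point (?L (- 18) (- 4) 0 0) (?L 36 8 0 0)"
      by (rule point_add_doubleI[where z = "?L (13 / 342) (- (5 / 342)) 0 0" and l = "0"]) (simp_all add: L)
    then show ?thesis
      using mordell_weil_pow_2[where P = ?T and K = ?K and E = ?E] by (simp del: point_add.simps)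
  qed
  have T_3: "?T [^]\<^bsub>?G\<^esub> (3 :: nat) = Affine_point (?L (- 18) (- 6) 0 0) (?L 36 18 0 0)"
  proof -
    have "point_add ?E (Affine_point (?L (- 18) (- 4) 0 0) (?L 36 8 0 0)) (Affine_point 0 0) = Affine_point (?L (- 18) (- 6) 0 0) (?L 36 18 0 0)"
      by (rule point_add_chordI[where z = "?L (3 / 38) (- (1 / 57)) 0 0" and l = "?L (- 2) 0 0 0"]) (simp_all add: L)
    then show ?thesis
      using pow_Suc[where P = ?T and n = 2] by (simp add: T_2 del: point_add.simps)
  qed
  have T_6: "?T [^]\<^bsub>?G\<^esub> (6 :: nat) = Affine_point (?L (- 18) (- 6) 0 0) (?L 36 12 0 0)"
  proof -
    have "point_add ?E (Affine_point (?L (- 18) (- 6) 0 0) (?L 36 18 0 0)) (Affine_point (?L (- 18) (- 6) 0 0) (?L 36 18 0 0)) = Affine_point (?L (- 18) (- 6) 0 0) (?L 36 12 0 0)"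
      by (rule point_add_doubleI[where z = "?L 0 (1 / 36) 0 0" and l = "?L (- 3) (- 1) 0 0"]) (simp_all add: L)
    then show ?thesis
      using pow_double[OF T, of 3] by (simp add: T_3 del: point_add.simps)
  qed
  have T_4: "?T [^]\<^bsub>?G\<^esub> (4 :: nat) = Affine_point (?L (- 12) (- 9) 0 0) (?L 6 33 0 0)"
  proof -
    have "point_add ?E (Affine_point (?L (- 18) (- 4) 0 0) (?L 36 8 0 0)) (Affine_point (?L (- 18) (- 4) 0 0) (?L 36 8 0 0)) = Affine_point (?L (- 12) (- 9) 0 0) (?L 6 33 0 0)"
      by (rule point_add_doubleI[where z = "?L (3 / 76) (- (1 / 114)) 0 0" and l = "?L (- 2) (- 1) 0 0"]) (simp_all add: L)
    then show ?thesis
      using pow_double[OF T, of 2] by (simp add: T_2 del: point_add.simps)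
  qed
  have T_8: "?T [^]\<^bsub>?G\<^esub> (8 :: nat) = Affine_point 0 (?L (- 234) (- 90) 0 0)"
  proof -
    have "point_add ?E (Affine_point (?L (- 12) (- 9) 0 0) (?L 6 33 0 0)) (Affine_point (?L (- 12) (- 9) 0 0) (?L 6 33 0 0)) = Affine_point 0 (?L (- 234) (- 90) 0 0)"
      by (rule point_add_doubleI[where z = "?L (8 / 57) (7 / 114) 0 0" and l = "?L (- 5) 1 0 0"]) (simp_all add: L)
    then show ?thesis
      using pow_double[OF T, of 4] by (simp add: T_4 del: point_add.simps)
  qed
  have T_9: "?T [^]\<^bsub>?G\<^esub> (9 :: nat) = Point_at_infinity"
    using pow_Suc[where P = ?T and n = 8] by (simp add: T_8 add: L)
  have S_2: "?S [^]\<^bsub>?G\<^esub> (2 :: nat) = Affine_point (?L (- 27) (- 6) 0 0) (?L 93 27 (- (15 / 2)) (3 / 2))"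
  proof -
    have "point_add ?E (Affine_point (?L (- 27) (- 6) 0 0) (?L 78 30 (15 / 2) (- (3 / 2)))) (Affine_point (?L (- 27) (- 6) 0 0) (?L 78 30 (15 / 2) (- (3 / 2)))) = Affine_point (?L (- 27) (- 6) 0 0) (?L 93 27 (- (15 / 2)) (3 / 2))"
      by (rule point_add_doubleI[where z = "?L (5 / 171) (1 / 171) (- (5 / 171)) (- (1 / 171))" and l = "?L (- 3) (- (5 / 3)) (- (5 / 2)) (1 / 6)"]) (simp_all add: L)
    then show ?thesis
      using mordell_weil_pow_2[where P = ?S and K = ?K and E = ?E] by (simp del: point_add.simps)
  qed
  have S_3: "?S [^]\<^bsub>?G\<^esub> (3 :: nat) = Point_at_infinity"
    using pow_Suc[where P = ?S and n = 2] by (simp add: S_2 add: L)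
  have ordT: "int (3 * 3) dvd b" if "?T [^]\<^bsub>?G\<^esub> b = \<one>\<^bsub>?G\<^esub>" for b :: int
  proof (rule G.int_pow_eq_one_imp_dvd[OF T _ _ _ that])
    fix q :: nat
    assume "prime q" "q dvd 3 * 3"
    then have "q dvd 3 ^ 2"
      by simp
    then have "q = 3"
      using \<open>prime q\<close> prime_dvd_power[of q 3 2] primes_dvd_imp_eq[of q 3] by simp
    then show "?T [^]\<^bsub>?G\<^esub> (3 * 3 div q) \<noteq> \<one>\<^bsub>?G\<^esub>"
      by (simp add: T_3)
  qed (simp_all add: T_9)
  have indep: "int 3 dvd a \<and> int 9 dvd b" if "?S [^]\<^bsub>?G\<^esub> a \<otimes>\<^bsub>?G\<^esub> ?T [^]\<^bsub>?G\<^esub> b = \<one>\<^bsub>?G\<^esub>" for a b :: int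
  proof -
    have "int (3) dvd a \<and> int (3 * 3) dvd b"
    proof (rule G.independent_of_prime_order[OF S T _ _ _ ordT _ that])
      show "?S [^]\<^bsub>?G\<^esub> (3 :: nat) = \<one>\<^bsub>?G\<^esub>" "?T [^]\<^bsub>?G\<^esub> (3 * 3 :: nat) = \<one>\<^bsub>?G\<^esub>"
        by (simp_all add: S_3 T_9)
      fix c :: nat
      assume "c < 3"
      then consider "c = 0" | "c = 1" | "c = 2"
        by linarith
      \<comment> \<open>The abscissa of \<open>S\<close> is \<open>- 27 - 6 r\<close>, that of
        \<open>3 T\<close> and \<open>6 T\<close> is \<open>- 18 - 6 r\<close>.\<close>
      then show "?S \<noteq> ?T [^]\<^bsub>?G\<^esub> (3 * c)"
        by cases (simp_all add: T_3 T_6 lin4_eq_iff lin4_eq_0_iff)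
    qed simp
    then show ?thesis
      by simp
  qed
  have "contains_subgroup_iso ?G (integer_mod_group 3 \<times>\<times> integer_mod_group 9 \<times>\<times> integer_group)"
  proof (rule G.contains_subgroup_iso_Zmod_Zmod_Z[OF S T Q])
    show "?S [^]\<^bsub>?G\<^esub> int 3 = \<one>\<^bsub>?G\<^esub>" "?T [^]\<^bsub>?G\<^esub> int 9 = \<one>\<^bsub>?G\<^esub>"
      by (simp_all only: int_pow_int S_3 T_9 mordell_weil_simps)
  qed (fact indep inf | simp)+
  then show ?thesis
    using number_field EK by blast
qed

text \<open>The curve is \<open>y\<^sup>2 = x (x + 24\<^sup>2) (x + 25\<^sup>2)\<close> in the coordinates \<open>x / 4\<close>, \<open>(y - x) / 8\<close>. As \<open>25\<^sup>2 - 24\<^sup>2 = 7\<^sup>2\<close>, its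
  4-torsion is rational over \<open>\<rat>(\<i>)\<close>, and the point with \<open>x = 24 * 25\<close> is divisible by 2 over \<open>\<rat>(\<surd>6)\<close>.
  The point \<open>Q\<close> is twice the one with \<open>x = 320\<close>.\<close>

lemma exists_Z4_Z8_Z:
  "\<exists>K E. number_field_of_degree 4 K \<and> elliptic_curve_over K E \<and>
    contains_subgroup_iso (mordell_weil_group K E)
      (integer_mod_group 4 \<times>\<times> integer_mod_group 8 \<times>\<times> integer_group)"
proof -
  define r u :: complex where "r = of_real (sqrt 6)" and "u = 1 + \<i>"
  have rr: "r * r = of_int (2 * 3) + of_int 0 * r"
    by (simp add: r_def flip: of_real_mult)
  have uu: "u * u = of_int (2 * (- 1)) + of_int 0 * r + (of_int 2 + of_int 0 * r) * u"
    by (simp add: u_def algebra_simps)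
  interpret even_quartic_basis r u "r * u"
  proof (rule even_quartic_basis_tower[OF _ _ _ rr uu])
    show "r \<notin> \<rat>"
      using complex_of_real_sqrt_notin_Rats[of 2 6] by (simp add: r_def power2_eq_square)
  qed (simp_all add: r_def u_def)
  let ?K = "rat_span r u (r * u)" and ?L = "lin4 r u (r * u)"
  note L = lin4_mult_tower[OF rr uu] Let_def lin4_simps power2_eq_square power3_eq_cube
  let ?E = "Weierstrass (?L 1 0 0 0) (?L 300 0 0 0) 0 (?L 22500 0 0 0) 0"
  have 0: "0 \<in> ?K" "0 \<in> int_span r u (r * u)"
    using subfield_closed(1)[OF subfield] R_diff[OF R1 R1] by auto
  have "discriminant ?E * (?L (1 / 1215506250000) 0 0 0) = 1"
    by (simp add: L)
  then have EK: "elliptic_curve_over ?K ?E"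
    using 0 by (auto simp: elliptic_curve_over_def intro!: lin4_rat_span)
  let ?G = "mordell_weil_group ?K ?E"
  interpret G: comm_group ?G
    using subfield EK by (rule comm_group_mordell_weil)
  note pow_double = mordell_weil_pow_double[OF subfield EK] and pow_Suc = mordell_weil_pow_Suc[where K = ?K and E = ?E]
  let ?Q = "Affine_point (?L (13225 / 864) 0 0 0) (?L (- (13225 / 1728)) (- (16426025 / 62208)) 0 0)"
  have "on_curve ?E ?Q"
    by (simp add: L)
  then have Q: "?Q \<in> carrier ?G"
    by (simp add: lin4_rat_span del: on_curve.simps)
  have inf: "k = 0" if "?Q [^]\<^bsub>?G\<^esub> k = \<one>\<^bsub>?G\<^esub>" for k :: int
  proof (rule infinite_order[OF subfield EK _ Q _ _ _ that])
    show "set_weierstrass ?E \<subseteq> int_span r u (r * u)"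
      using 0 by (auto intro!: lin4_int_span)
    show "?L (13225 / 864) 0 0 0 * (4 * ?L 216 0 0 0) = ?L 13225 0 0 0"
      by (simp add: L)
    show "?L 216 0 0 0 \<in> even_span r u (r * u)"
      by (rule lin4_even_span) simp_all
    show "cong1 (?L 13225 0 0 0)"
      by (rule cong1_lin4) simp_all
  qed
  let ?T = "Affine_point (?L (- 60) (- 35) 0 0) (?L 450 (- 175) 0 0)"
  have "on_curve ?E ?T"
    by (simp add: L)
  then have T: "?T \<in> carrier ?G"
    using 0 by (simp add: lin4_rat_span del: on_curve.simps)
  let ?S = "Affine_point (?L (- 200) 0 0 0) (?L (- 600) 0 700 0)"
  have "on_curve ?E ?S"
    by (simp add: L)
  then have S: "?S \<in> carrier ?G"
    using 0 by (simp add: lin4_rat_span del: on_curve.simps)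
  have T_2: "?T [^]\<^bsub>?G\<^esub> (2 :: nat) = Affine_point (?L 150 0 0 0) (?L (- 3750) 0 0 0)"
  proof -
    have "point_add ?E (Affine_point (?L (- 60) (- 35) 0 0) (?L 450 (- 175) 0 0)) (Affine_point (?L (- 60) (- 35) 0 0) (?L 450 (- 175) 0 0)) = Affine_point (?L 150 0 0 0) (?L (- 3750) 0 0 0)"
      by (rule point_add_doubleI[where z = "?L (- (4 / 875)) (- (11 / 5250)) 0 0" and l = "?L 17 (- 2) 0 0"]) (simp_all add: L)
    then show ?thesis
      using mordell_weil_pow_2[where P = ?T and K = ?K and E = ?E] by (simp del: point_add.simps)
  qed
  have T_4: "?T [^]\<^bsub>?G\<^esub> (4 :: nat) = Affine_point 0 0"
  proof -
    have "point_add ?E (Affine_point (?L 150 0 0 0) (?L (- 3750) 0 0 0)) (Affine_point (?L 150 0 0 0) (?L (- 3750) 0 0 0)) = Affine_point 0 0"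
      by (rule point_add_doubleI[where z = "?L (- (1 / 7350)) 0 0 0" and l = "?L (- 25) 0 0 0"]) (simp_all add: L)
    then show ?thesis
      using pow_double[OF T, of 2] by (simp add: T_2 del: point_add.simps)
  qed
  have T_8: "?T [^]\<^bsub>?G\<^esub> (8 :: nat) = Point_at_infinity"
    using pow_double[OF T, of 4] by (simp add: T_4 add: L)
  have S_2: "?S [^]\<^bsub>?G\<^esub> (2 :: nat) = Affine_point (?L (- (625 / 4)) 0 0 0) (?L (625 / 8) 0 0 0)"
  proof -
    have "point_add ?E (Affine_point (?L (- 200) 0 0 0) (?L (- 600) 0 700 0)) (Affine_point (?L (- 200) 0 0 0) (?L (- 600) 0 700 0)) = Affine_point (?L (- (625 / 4)) 0 0 0) (?L (625 / 8) 0 0 0)"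
      by (rule point_add_doubleI[where z = "?L (1 / 1400) 0 (- (1 / 1400)) 0" and l = "?L (31 / 2) 0 (- 16) 0"]) (simp_all add: L)
    then show ?thesis
      using mordell_weil_pow_2[where P = ?S and K = ?K and E = ?E] by (simp del: point_add.simps)
  qed
  have S_4: "?S [^]\<^bsub>?G\<^esub> (4 :: nat) = Point_at_infinity"
    using pow_double[OF S, of 2] by (simp add: S_2 add: L)
  have ordT: "int (2 * 4) dvd b" if "?T [^]\<^bsub>?G\<^esub> b = \<one>\<^bsub>?G\<^esub>" for b :: int
  proof (rule G.int_pow_eq_one_imp_dvd[OF T _ _ _ that])
    fix q :: nat
    assume "prime q" "q dvd 2 * 4"
    then have "q dvd 2 ^ 3"
      by simp
    then have "q = 2"
      using \<open>prime q\<close> prime_dvd_power[of q 2 3] primes_dvd_imp_eq[of q 2] by simp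
    then show "?T [^]\<^bsub>?G\<^esub> (2 * 4 div q) \<noteq> \<one>\<^bsub>?G\<^esub>"
      by (simp add: T_4)
  qed (simp_all add: T_8)
  have indep: "int 4 dvd a \<and> int 8 dvd b" if "?S [^]\<^bsub>?G\<^esub> a \<otimes>\<^bsub>?G\<^esub> ?T [^]\<^bsub>?G\<^esub> b = \<one>\<^bsub>?G\<^esub>" for a b :: int
  proof -
    have "int (2 * 2) dvd a \<and> int (2 * 4) dvd b"
    proof (rule G.independent_of_prime_square_order[OF S T _ _ _ ordT _ that])
      show "?S [^]\<^bsub>?G\<^esub> (2 * 2 :: nat) = \<one>\<^bsub>?G\<^esub>" "?T [^]\<^bsub>?G\<^esub> (2 * 4 :: nat) = \<one>\<^bsub>?G\<^esub>"
        by (simp_all add: S_4 T_8)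
      fix c :: nat
      assume "c < 2"
      then consider "c = 0" | "c = 1"
        by linarith
      \<comment> \<open>It suffices that \<open>2 S\<close>, with abscissa \<open>- 625 / 4\<close>,
        is neither zero nor the point \<open>4 T = (0, 0)\<close> of order 2.\<close>
      then show "?S [^]\<^bsub>?G\<^esub> (2 :: nat) \<noteq> ?T [^]\<^bsub>?G\<^esub> (4 * c)"
        by cases (simp_all add: S_2 T_4 lin4_eq_iff lin4_eq_0_iff)
    qed simp
    then show ?thesis
      by simp
  qed
  have "contains_subgroup_iso ?G (integer_mod_group 4 \<times>\<times> integer_mod_group 8 \<times>\<times> integer_group)"
  proof (rule G.contains_subgroup_iso_Zmod_Zmod_Z[OF S T Q])
    show "?S [^]\<^bsub>?G\<^esub> int 4 = \<one>\<^bsub>?G\<^esub>" "?T [^]\<^bsub>?G\<^esub> int 8 = \<one>\<^bsub>?G\<^esub>"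
      by (simp_all only: int_pow_int S_4 T_8 mordell_weil_simps)
  qed (fact indep inf | simp)+
  then show ?thesis
    using number_field EK by blast
qed

text \<open>The Tate normal form of a point of order 5 with parameter \<open>b = c = 11 / 2\<close>, over the field of fifth roots of
  unity; \<open>u\<close> is \<open>2 (\<zeta> - \<zeta>\<^sup>-\<^sup>1)\<close>. The parameter is the value at \<open>t = 2\<close> of
  \<open>(1 + 3 t + 4 t\<^sup>2 + 2 t ^ 3 + t ^ 4) / (t (1 - 2 t + 4 t\<^sup>2 - 3 t ^ 3 + t ^ 4))\<close>, where the full 5-torsion is rational.\<close>

lemma exists_Z5_Z5_Z:
  "\<exists>K E. number_field_of_degree 4 K \<and> elliptic_curve_over K E \<and>
    contains_subgroup_iso (mordell_weil_group K E)
      (integer_mod_group 5 \<times>\<times> integer_mod_group 5 \<times>\<times> integer_group)"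
proof -
  \<comment> \<open>Here \<open>r\<^sup>2 = 2 r + 4\<close>; for the golden ratio or
    \<open>\<surd>5\<close> the constant term would be odd.\<close>
  define r u :: complex where "r = 1 + of_real (sqrt 5)" and "u = \<i> * of_real (sqrt (10 + 2 * sqrt 5))"
  have rr: "r * r = of_int (2 * 2) + of_int 2 * r"
    by (simp add: r_def algebra_simps flip: of_real_mult)
  have uu: "u * u = of_int (2 * (- 4)) + of_int (- 2) * r + (of_int 0 + of_int 0 * r) * u"
    using imaginary_sqrt_squared[of "10 + 2 * sqrt 5"] by (simp add: u_def r_def)
  interpret even_quartic_basis r u "r * u"
  proof (rule even_quartic_basis_tower[OF _ _ _ rr uu])
    show "r \<notin> \<rat>"
    proof
      assume "r \<in> \<rat>"
      then have "r - 1 \<in> \<rat>"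
        by simp
      then show False
        using complex_of_real_sqrt_notin_Rats[of 2 5] by (simp add: r_def power2_eq_square)
    qed
    have "10 + 2 * sqrt 5 > (0 :: real)"
      by (intro add_pos_nonneg) auto
    then show "Im u \<noteq> 0"
      by (simp add: u_def)
  qed (simp add: r_def)
  let ?K = "rat_span r u (r * u)" and ?L = "lin4 r u (r * u)"
  note L = lin4_mult_tower[OF rr uu] Let_def lin4_simps power2_eq_square power3_eq_cube
  let ?E = "Weierstrass (?L (- 9) 0 0 0) (?L (- 22) 0 0 0) (?L (- 44) 0 0 0) 0 0"
  have 0: "0 \<in> ?K" "0 \<in> int_span r u (r * u)"
    using subfield_closed(1)[OF subfield] R_diff[OF R1 R1] by auto
  have "discriminant ?E * (?L (- (1 / 644204000)) 0 0 0) = 1"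
    by (simp add: L)
  then have EK: "elliptic_curve_over ?K ?E"
    using 0 by (auto simp: elliptic_curve_over_def intro!: lin4_rat_span)
  let ?G = "mordell_weil_group ?K ?E"
  interpret G: comm_group ?G
    using subfield EK by (rule comm_group_mordell_weil)
  note pow_double = mordell_weil_pow_double[OF subfield EK] and pow_Suc = mordell_weil_pow_Suc[where K = ?K and E = ?E]
  let ?Q = "Affine_point (?L (- (213191 / 184320)) 0 0 0) (?L (4225802867 / 176947200) (- (1253949587 / 176947200)) 0 0)"
  have "on_curve ?E ?Q"
    by (simp add: L)
  then have Q: "?Q \<in> carrier ?G"
    by (simp add: lin4_rat_span del: on_curve.simps)
  have inf: "k = 0" if "?Q [^]\<^bsub>?G\<^esub> k = \<one>\<^bsub>?G\<^esub>" for k :: int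
  proof (rule infinite_order[OF subfield EK _ Q _ _ _ that])
    show "set_weierstrass ?E \<subseteq> int_span r u (r * u)"
      using 0 by (auto intro!: lin4_int_span)
    show "?L (- (213191 / 184320)) 0 0 0 * (4 * ?L 46080 0 0 0) = ?L (- 213191) 0 0 0"
      by (simp add: L)
    show "?L 46080 0 0 0 \<in> even_span r u (r * u)"
      by (rule lin4_even_span) simp_all
    show "cong1 (?L (- 213191) 0 0 0)"
      by (rule cong1_lin4) simp_all
  qed
  let ?T = "Affine_point 0 0 :: complex point"
  have T: "?T \<in> carrier ?G"
    using 0 by simp
  let ?S = "Affine_point (?L (- 22) (11 / 2) 0 0) (?L (- 77) (99 / 4) (209 / 4) (- (143 / 8)))"
  have "on_curve ?E ?S"
    by (simp add: L)
  then have S: "?S \<in> carrier ?G"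
    using 0 by (simp add: lin4_rat_span del: on_curve.simps)
  have T_2: "?T [^]\<^bsub>?G\<^esub> (2 :: nat) = Affine_point (?L 22 0 0 0) (?L 242 0 0 0)"
  proof -
    have "point_add ?E (Affine_point 0 0) (Affine_point 0 0) = Affine_point (?L 22 0 0 0) (?L 242 0 0 0)"
      by (rule point_add_doubleI[where z = "?L (- (1 / 44)) 0 0 0" and l = "0"]) (simp_all add: L)
    then show ?thesis
      using mordell_weil_pow_2[where P = ?T and K = ?K and E = ?E] by (simp del: point_add.simps)
  qed
  have T_3: "?T [^]\<^bsub>?G\<^esub> (3 :: nat) = Affine_point (?L 22 0 0 0) 0"
  proof -
    have "point_add ?E (Affine_point (?L 22 0 0 0) (?L 242 0 0 0)) (Affine_point 0 0) = Affine_point (?L 22 0 0 0) 0"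
      by (rule point_add_chordI[where z = "?L (- (1 / 22)) 0 0 0" and l = "?L 11 0 0 0"]) (simp_all add: L)
    then show ?thesis
      using pow_Suc[where P = ?T and n = 2] by (simp add: T_2 del: point_add.simps)
  qed
  have T_4: "?T [^]\<^bsub>?G\<^esub> (4 :: nat) = Affine_point 0 (?L 44 0 0 0)"
  proof -
    have "point_add ?E (Affine_point (?L 22 0 0 0) (?L 242 0 0 0)) (Affine_point (?L 22 0 0 0) (?L 242 0 0 0)) = Affine_point 0 (?L 44 0 0 0)"
      by (rule point_add_doubleI[where z = "?L (1 / 242) 0 0 0" and l = "?L 11 0 0 0"]) (simp_all add: L)
    then show ?thesis
      using pow_double[OF T, of 2] by (simp add: T_2 del: point_add.simps)
  qed
  have T_5: "?T [^]\<^bsub>?G\<^esub> (5 :: nat) = Point_at_infinity"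
    using pow_Suc[where P = ?T and n = 4] by (simp add: T_4 add: L)
  have S_2: "?S [^]\<^bsub>?G\<^esub> (2 :: nat) = Affine_point (?L (- 11) (- (11 / 2)) 0 0) (?L (- (55 / 2)) (- (99 / 4)) (77 / 4) (33 / 4))"
  proof -
    have "point_add ?E (Affine_point (?L (- 22) (11 / 2) 0 0) (?L (- 77) (99 / 4) (209 / 4) (- (143 / 8)))) (Affine_point (?L (- 22) (11 / 2) 0 0) (?L (- 77) (99 / 4) (209 / 4) (- (143 / 8)))) = Affine_point (?L (- 11) (- (11 / 2)) 0 0) (?L (- (55 / 2)) (- (99 / 4)) (77 / 4) (33 / 4))"
      by (rule point_add_doubleI[where z = "?L 0 0 (1 / 1210) (1 / 605)" and l = "?L (9 / 2) 0 (- 2) (9 / 8)"]) (simp_all add: L)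
    then show ?thesis
      using mordell_weil_pow_2[where P = ?S and K = ?K and E = ?E] by (simp del: point_add.simps)
  qed
  have S_4: "?S [^]\<^bsub>?G\<^esub> (4 :: nat) = Affine_point (?L (- 22) (11 / 2) 0 0) (?L (- 77) (99 / 4) (- (209 / 4)) (143 / 8))"
  proof -
    have "point_add ?E (Affine_point (?L (- 11) (- (11 / 2)) 0 0) (?L (- (55 / 2)) (- (99 / 4)) (77 / 4) (33 / 4))) (Affine_point (?L (- 11) (- (11 / 2)) 0 0) (?L (- (55 / 2)) (- (99 / 4)) (77 / 4) (33 / 4))) = Affine_point (?L (- 22) (11 / 2) 0 0) (?L (- 77) (99 / 4) (- (209 / 4)) (143 / 8))"
      by (rule point_add_doubleI[where z = "?L 0 0 (- (9 / 1210)) (1 / 484)" and l = "?L (9 / 2) 0 (- (5 / 2)) (1 / 8)"]) (simp_all add: L)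
    then show ?thesis
      using pow_double[OF S, of 2] by (simp add: S_2 del: point_add.simps)
  qed
  have S_5: "?S [^]\<^bsub>?G\<^esub> (5 :: nat) = Point_at_infinity"
    using pow_Suc[where P = ?S and n = 4] by (simp add: S_4 add: L)
  have ordT: "int (5 * 1) dvd b" if "?T [^]\<^bsub>?G\<^esub> b = \<one>\<^bsub>?G\<^esub>" for b :: int
    using G.int_pow_eq_one_imp_prime_dvd[OF T _ _ _ that, of 5] by (simp add: T_5)
  have indep: "int 5 dvd a \<and> int 5 dvd b" if "?S [^]\<^bsub>?G\<^esub> a \<otimes>\<^bsub>?G\<^esub> ?T [^]\<^bsub>?G\<^esub> b = \<one>\<^bsub>?G\<^esub>" for a b :: int
  proof -
    have "int (5) dvd a \<and> int (5 * 1) dvd b"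
    proof (rule G.independent_of_prime_order[OF S T _ _ _ ordT _ that])
      show "?S [^]\<^bsub>?G\<^esub> (5 :: nat) = \<one>\<^bsub>?G\<^esub>" "?T [^]\<^bsub>?G\<^esub> (5 * 1 :: nat) = \<one>\<^bsub>?G\<^esub>"
        by (simp_all add: S_5 T_5)
      fix c :: nat
      assume "c < 5"
      then consider "c = 0" | "c = 1" | "c = 2" | "c = 3" | "c = 4"
        by linarith
      \<comment> \<open>The nonzero multiples of \<open>T\<close> have abscissas 0 and 22, whereas
        that of \<open>S\<close> is irrational.\<close>
      then show "?S \<noteq> ?T [^]\<^bsub>?G\<^esub> (1 * c)"
        by cases (simp_all add: T_2 T_3 T_4 lin4_eq_iff lin4_eq_0_iff)
    qed simp
    then show ?thesis
      by simp
  qed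
  have "contains_subgroup_iso ?G (integer_mod_group 5 \<times>\<times> integer_mod_group 5 \<times>\<times> integer_group)"
  proof (rule G.contains_subgroup_iso_Zmod_Zmod_Z[OF S T Q])
    show "?S [^]\<^bsub>?G\<^esub> int 5 = \<one>\<^bsub>?G\<^esub>" "?T [^]\<^bsub>?G\<^esub> int 5 = \<one>\<^bsub>?G\<^esub>"
      by (simp_all only: int_pow_int S_5 T_5 mordell_weil_simps)
  qed (fact indep inf | simp)+
  then show ?thesis
    using number_field EK by blast
qed

theorem theorem3p4:
  shows "(\<exists>K E. number_field_of_degree 4 K \<and> elliptic_curve_over K E \<and>
      contains_subgroup_iso (mordell_weil_group K E)
        (integer_mod_group 17 \<times>\<times> integer_group)) \<and>
    (\<exists>K E. number_field_of_degree 4 K \<and> elliptic_curve_over K E \<and>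
      contains_subgroup_iso (mordell_weil_group K E)
        (integer_mod_group 21 \<times>\<times> integer_group)) \<and>
    (\<exists>K E. number_field_of_degree 4 K \<and> elliptic_curve_over K E \<and>
      contains_subgroup_iso (mordell_weil_group K E)
        (integer_mod_group 3 \<times>\<times> integer_mod_group 9 \<times>\<times> integer_group)) \<and>
    (\<exists>K E. number_field_of_degree 4 K \<and> elliptic_curve_over K E \<and>
      contains_subgroup_iso (mordell_weil_group K E)
        (integer_mod_group 4 \<times>\<times> integer_mod_group 8 \<times>\<times> integer_group)) \<and>
    (\<exists>K E. number_field_of_degree 4 K \<and> elliptic_curve_over K E \<and>
      contains_subgroup_iso (mordell_weil_group K E)
        (integer_mod_group 5 \<times>\<times> integer_mod_group 5 \<times>\<times> integer_group))"
  by (intro conjI exists_Z17_Z exists_Z21_Z exists_Z3_Z9_Z exists_Z4_Z8_Z exists_Z5_Z5_Z)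

end
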